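(* Let $p>2$ be a prime, let $a$ and $b$ be even integers with $0\le a<b\le p-1$, let $n,s$ be integers with $1\le n\le s$, and let $i$ be an arbitrary non-negative integer. With $k_r^{(s)}\in\mathbb{Z}$, $\alpha(a,b)\in\mathbb{Z}_p$ and the ($p$-adic) $q$-binomial coefficients as described in the context, the following hold. (a) For every integer $m$ with $1\le m\le n$, $$\sum_{r=0}^{2^n-1}(-1)^r\genfrac{[}{]}{0pt}{}{k_r^{(s)}/2}{i}_q\genfrac{[}{]}{0pt}{}{\alpha(a,b)-i}{k_r^{(s)}/2}_q\equiv 0\pmod{\Phi_{p^m}(q)}\quad\text{in }\mathbb{Z}_p[q],$$ where $\Phi_{p^m}(q)$ is the $p^m$-th cyclotomic polynomial. (b) $$\sum_{r=0}^{2^n-1}(-1)^r\genfrac{[}{]}{0pt}{}{k_r^{(s)}/2}{i}_q\genfrac{[}{]}{0pt}{}{\alpha(a,b)-i}{k_r^{(s)}/2}_q\equiv 0\pmod{[p^n]_q}\quad\text{in }\mathbb{Z}_p[q],$$ where $[p^n]_q=\frac{1-q^{p^n}}{1-q}$. (c) $$\sum_{r=0}^{2^n-1}(-1)^r\binom{k_r^{(s)}/2}{i}\binom{\alpha(a,b)-i}{k_r^{(s)}/2}\equiv 0\pmod{p^n}\quad\text{in }\mathbb{Z}_p.$$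
   Context: For a non-negative integer $r$ with binary expansion $r=\sum_{j\ge 0} r_j2^j$, $r_j\in\{0,1\}$, set $k_r:=\sum_{j=0}^{\infty}\big((b-a)r_j+a\big)p^j\in\mathbb{Z}_p$, and let $k_r^{(s)}:=\sum_{j=0}^{s-1}\big((b-a)r_j+a\big)p^j\in\mathbb{Z}$ be its truncation to the first $s$ $p$-adic digits. Since $a,b$ are even, $k_r^{(s)}/2$ is a non-negative integer. Set $\alpha(a,b):=\sum_{j=0}^{\infty}\frac{a+b}{2}p^j=\frac{a+b}{2(1-p)}\in\mathbb{Z}_p$. For integers $0\le k\le N$, $\genfrac{[}{]}{0pt}{}{N}{k}_q=\frac{[N]_q!}{[k]_q!\,[N-k]_q!}\in\mathbb{Z}[q]$, where $[N]_q=\frac{1-q^N}{1-q}$ and $[N]_q!=\prod_{j=1}^N[j]_q$, $[0]_q!=1$; it is $0$ for $0\le N<k$. For $x\in\mathbb{Z}_p$ and an integer $k\ge 0$, the $q$-binomial coefficient $\genfrac{[}{]}{0pt}{}{x}{k}_q$ is taken to be an element of $\mathbb{Z}_p[q]$, extending the case of integer $x$ by continuity of $x\mapsto\genfrac{[}{]}{0pt}{}{x}{k}_q$ (continuity over extensions of $\mathbb{Q}_p$, in particular over $\mathbb{Q}_p[\zeta_{p^m}]$ with $\zeta_{p^m}$ a primitive $p^m$-th root of unity). Ordinary binomial coefficients are generalized: $\binom{x}{k}=\frac{x(x-1)\cdots(x-k+1)}{k!}\in\mathbb{Z}_p$ for $x\in\mathbb{Z}_p$, $k\ge 0$, with $\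binom{x}{0}=1$.
   Formalization: The q-binomial with upper argument α(a,b)−i is in general not an element of Z_p[q]; in (a) and (b) it is read as the p-adic limit in Z_p[q]/(P), represented by a polynomial of degree below deg P, where P is the modulus Φ_{p^m}(q) or [p^n]_q. *)

theory Defs
  imports
    "HOL-Computational_Algebra.Computational_Algebra"
    "Berlekamp_Zassenhaus.Finite_Field"
begin

hide_const (open) up_ring.monom up_ring.coeff module.smult

section \<open>The ring of p-adic integers\<close>

text \<open>
  The prime is carried by a type: \<open>'p\<close> ranges over the types of prime cardinality, and
  \<open>'p padic_int\<close> is the ring of \<open>p\<close>-adic integers for \<open>p = CARD('p)\<close>, the inverse limit of the
  rings of integers modulo \<open>p ^ n\<close>.  An element is its coherent sequence of residues, the \<open>n\<close>-th of
  which is the representative in \<open>{0..<p ^ n}\<close>.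
\<close>

typedef (overloaded) 'p padic_int =
  "{f :: nat \<Rightarrow> int. \<forall>n. f n = f (Suc n) mod int CARD('p :: prime_card) ^ n}"
  morphisms residue Abs_padic_int
  by (rule exI[of _ "\<lambda>_. 0"]) simp

setup_lifting type_definition_padic_int

lemma residue_Suc: "residue (x :: 'p::prime_card padic_int) n = residue x (Suc n) mod int CARD('p) ^ n"
  using residue[of x] unfolding mem_Collect_eq by (rule spec)

lemma residue_Abs_padic_int:
  assumes "\<And>n. f n = f (Suc n) mod int CARD('p) ^ n"
  shows "residue (Abs_padic_int f :: 'p::prime_card padic_int) = f"
  by (intro Abs_padic_int_inverse CollectI allI assms)

lemma mod_Suc_power: "(x::int) mod q ^ Suc n mod q ^ n = x mod q ^ n"
  by (rule mod_mod_cancel) simp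

lemma residue_coherent_add:
  fixes f g :: "nat \<Rightarrow> int"
  assumes "\<And>n. f n = f (Suc n) mod q ^ n" "\<And>n. g n = g (Suc n) mod q ^ n"
  shows "(f n + g n) mod q ^ n = (f (Suc n) + g (Suc n)) mod q ^ Suc n mod q ^ n"
  unfolding mod_Suc_power by (simp only: assms(1)[of n] assms(2)[of n] mod_add_eq)

lemma residue_coherent_mult:
  fixes f g :: "nat \<Rightarrow> int"
  assumes "\<And>n. f n = f (Suc n) mod q ^ n" "\<And>n. g n = g (Suc n) mod q ^ n"
  shows "(f n * g n) mod q ^ n = (f (Suc n) * g (Suc n)) mod q ^ Suc n mod q ^ n"
  unfolding mod_Suc_power by (simp only: assms(1)[of n] assms(2)[of n] mod_mult_eq)

lemma residue_coherent_minus: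
  fixes f :: "nat \<Rightarrow> int"
  assumes "\<And>n. f n = f (Suc n) mod q ^ n"
  shows "(- f n) mod q ^ n = (- f (Suc n)) mod q ^ Suc n mod q ^ n"
  unfolding mod_Suc_power by (simp only: assms[of n] mod_minus_eq)

lemma residue_coherent_diff:
  fixes f g :: "nat \<Rightarrow> int"
  assumes "\<And>n. f n = f (Suc n) mod q ^ n" "\<And>n. g n = g (Suc n) mod q ^ n"
  shows "(f n - g n) mod q ^ n = (f (Suc n) - g (Suc n)) mod q ^ Suc n mod q ^ n"
  unfolding mod_Suc_power by (simp only: assms(1)[of n] assms(2)[of n] mod_diff_eq)

lemma CARD_prime_card_gt_1: "1 < CARD('p :: prime_card)"
  using prime_card prime_gt_1_nat by blast

lemma residue_mod: "residue (x :: 'p::prime_card padic_int) n mod int CARD('p) ^ n = residue x n"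
  by (simp only: residue_Suc[of x n] mod_mod_trivial)

lemma padic_int_eqI:
  "(\<And>n. residue x n mod int CARD('p) ^ n = residue y n mod int CARD('p) ^ n) \<Longrightarrow> x = (y :: 'p::prime_card padic_int)"
  by (rule residue_inject[THEN iffD1], rule ext) (simp only: residue_mod)

instantiation padic_int :: (prime_card) comm_ring_1
begin

lift_definition zero_padic_int :: "'a padic_int" is "\<lambda>_. 0" by simp
lift_definition one_padic_int :: "'a padic_int" is "\<lambda>n. 1 mod int CARD('a) ^ n"
  by (simp only: mod_Suc_power)
lift_definition plus_padic_int :: "'a padic_int \<Rightarrow> 'a padic_int \<Rightarrow> 'a padic_int"
  is "\<lambda>f g n. (f n + g n) mod int CARD('a) ^ n" using residue_coherent_add by blast
lift_definition minus_padic_int :: "'a padic_int \<Rightarrow> 'a padic_int \<Rightarrow> 'a padic_int"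
  is "\<lambda>f g n. (f n - g n) mod int CARD('a) ^ n" using residue_coherent_diff by blast
lift_definition uminus_padic_int :: "'a padic_int \<Rightarrow> 'a padic_int"
  is "\<lambda>f n. (- f n) mod int CARD('a) ^ n" using residue_coherent_minus by blast
lift_definition times_padic_int :: "'a padic_int \<Rightarrow> 'a padic_int \<Rightarrow> 'a padic_int"
  is "\<lambda>f g n. (f n * g n) mod int CARD('a) ^ n" using residue_coherent_mult by blast

instance
proof
  fix a b c :: "'a padic_int"
  show "a * b * c = a * (b * c)"
    by (rule padic_int_eqI) (simp add: times_padic_int.rep_eq mod_simps mult.assoc)
  show "a * b = b * a"
    by (rule padic_int_eqI) (simp add: times_padic_int.rep_eq mult.commute)
  show "1 * a = a"
    by (rule padic_int_eqI) (simp add: times_padic_int.rep_eq one_padic_int.rep_eq mod_simps)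
  show "(a + b) * c = a * c + b * c"
    by (rule padic_int_eqI) (simp add: times_padic_int.rep_eq plus_padic_int.rep_eq mod_simps algebra_simps)
  show "a + b + c = a + (b + c)"
    by (rule padic_int_eqI) (simp add: plus_padic_int.rep_eq mod_simps add.assoc)
  show "a + b = b + a"
    by (rule padic_int_eqI) (simp add: plus_padic_int.rep_eq add.commute)
  show "0 + a = a"
    by (rule padic_int_eqI) (simp add: plus_padic_int.rep_eq zero_padic_int.rep_eq)
  show "- a + a = 0"
    by (rule padic_int_eqI)
      (simp add: plus_padic_int.rep_eq zero_padic_int.rep_eq uminus_padic_int.rep_eq mod_simps)
  show "a - b = a + - b"
    by (rule padic_int_eqI)
      (simp add: plus_padic_int.rep_eq minus_padic_int.rep_eq uminus_padic_int.rep_eq mod_simps)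
  show "(0::'a padic_int) \<noteq> 1"
  proof
    assume "(0::'a padic_int) = 1"
    then have "residue (0::'a padic_int) 1 = residue (1::'a padic_int) 1" by simp
    then have "1 mod int CARD('a) = 0"
      by (simp add: zero_padic_int.rep_eq one_padic_int.rep_eq)
    with CARD_prime_card_gt_1[where ?'p = 'a] show False by simp
  qed
qed

end

lemma residue_of_nat: "residue (of_nat k :: 'p::prime_card padic_int) n = int k mod int CARD('p) ^ n"
proof (induction k)
  case 0
  show ?case by (simp add: zero_padic_int.rep_eq)
next
  case (Suc k)
  then show ?case
    by (simp add: plus_padic_int.rep_eq one_padic_int.rep_eq) (simp add: mod_simps)
qed

lemma residue_nonneg: "0 \<le> residue (x :: 'p::prime_card padic_int) n"
proof -
  have "0 < int CARD('p) ^ n" using CARD_prime_card_gt_1[where ?'p = 'p] by simp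
  then have "0 \<le> residue x n mod int CARD('p) ^ n" by simp
  then show ?thesis by (simp add: residue_mod)
qed

lemma residue_le:
  assumes "m \<le> n"
  shows "residue (x :: 'p::prime_card padic_int) m = residue x n mod int CARD('p) ^ m"
  using assms
proof (induction n rule: dec_induct)
  case base
  show ?case by (simp only: residue_mod)
next
  case (step n)
  have "residue x m = residue x (Suc n) mod int CARD('p) ^ n mod int CARD('p) ^ m"
    using step.IH residue_Suc[of x n] by metis
  also have "\<dots> = residue x (Suc n) mod int CARD('p) ^ m"
    using step.hyps by (intro mod_mod_cancel le_imp_power_dvd)
  finally show ?case .
qed

lemma residue_p_power: "residue (of_nat CARD('p) ^ k :: 'p::prime_card padic_int) n = int CARD('p) ^ k mod int CARD('p) ^ n"
  using residue_of_nat[of "CARD('p) ^ k" n, where ?'p = 'p] by simp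

lemma p_power_dvd_iff:
  "of_nat CARD('p) ^ n dvd (x :: 'p::prime_card padic_int) \<longleftrightarrow> residue x n = 0"
proof
  assume "of_nat CARD('p) ^ n dvd x"
  then obtain y where "x = of_nat CARD('p) ^ n * y" ..
  then show "residue x n = 0"
    by (simp only: times_padic_int.rep_eq residue_p_power) simp
next
  assume *: "residue x n = 0"
  let ?p = "int CARD('p)"
  have p: "?p > 1" using CARD_prime_card_gt_1[where ?'p = 'p] by simp
  define f where "f k = residue x (n + k) div ?p ^ n" for k
  have d: "?p ^ n dvd residue x (n + k)" for k
    using * residue_le[of n "n + k" x] by auto
  have f: "f k = f (Suc k) mod ?p ^ k" for k
  proof -
    have "residue x (n + k) = residue x (n + Suc k) mod (?p ^ n * ?p ^ k)"
      using residue_Suc[of x "n + k"] by (simp add: power_add)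
    also have "\<dots> = (?p ^ n * f (Suc k)) mod (?p ^ n * ?p ^ k)"
      using d[of "Suc k"] by (simp add: f_def)
    also have "\<dots> = ?p ^ n * (f (Suc k) mod ?p ^ k)" by (simp only: mult_mod_right)
    finally show ?thesis using p by (simp add: f_def)
  qed
  define y where "y = (Abs_padic_int f :: 'p padic_int)"
  have y: "residue y = f" unfolding y_def by (rule residue_Abs_padic_int) (rule f)
  have "x = of_nat CARD('p) ^ n * y"
  proof (rule padic_int_eqI)
    fix k
    have "residue (of_nat CARD('p) ^ n * y) k = (?p ^ n * f k) mod ?p ^ k"
      by (simp only: times_padic_int.rep_eq residue_p_power y mod_mult_left_eq)
    also have "?p ^ n * f k = residue x (n + k)" using d[of k] by (simp add: f_def)
    also have "\<dots> mod ?p ^ k = residue x k" using residue_le[of k "n + k" x] by simp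
    finally show "residue x k mod ?p ^ k = residue (of_nat CARD('p) ^ n * y) k mod ?p ^ k" by simp
  qed
  then show "of_nat CARD('p) ^ n dvd x" by simp
qed

lemma p_power_dvd_all:
  assumes "\<And>n. of_nat CARD('p) ^ n dvd (x :: 'p::prime_card padic_int)"
  shows "x = 0"
  using assms by (intro padic_int_eqI) (simp add: p_power_dvd_iff zero_padic_int.rep_eq)

lemma p_power_dvd_diff_residue:
  "of_nat CARD('p) ^ n dvd (x :: 'p::prime_card padic_int) - of_nat (nat (residue x n))"
  by (simp only: p_power_dvd_iff minus_padic_int.rep_eq residue_of_nat)
    (simp only: nat_0_le[OF residue_nonneg] residue_mod diff_self mod_0)

lemma p_power_dvd_diff_iff:
  "of_nat CARD('p) ^ n dvd (x :: 'p::prime_card padic_int) - y \<longleftrightarrow> residue x n = residue y n"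
proof -
  have "of_nat CARD('p) ^ n dvd x - y \<longleftrightarrow>
      residue x n mod int CARD('p) ^ n = residue y n mod int CARD('p) ^ n"
    by (simp only: p_power_dvd_iff minus_padic_int.rep_eq mod_eq_dvd_iff dvd_eq_mod_eq_0)
  then show ?thesis by (simp only: residue_mod)
qed

lemma p_power_dvd_of_nat:
  "(of_nat CARD('p) ^ n :: 'p::prime_card padic_int) dvd of_nat k \<longleftrightarrow> CARD('p) ^ n dvd k"
proof -
  have "residue (of_nat k :: 'p padic_int) n = int (k mod CARD('p) ^ n)"
    by (simp add: residue_of_nat zmod_int)
  then show ?thesis by (simp add: p_power_dvd_iff dvd_eq_mod_eq_0)
qed

instance padic_int :: (prime_card) idom
proof
  fix x y :: "'a padic_int"
  assume "x \<noteq> 0" "y \<noteq> 0"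
  let ?p = "int CARD('a)"
  have prime: "prime ?p" by (rule prime_card_int)
  from \<open>x \<noteq> 0\<close> obtain m where m: "residue x m \<noteq> 0" using p_power_dvd_all p_power_dvd_iff by blast
  from \<open>y \<noteq> 0\<close> obtain n where n: "residue y n \<noteq> 0" using p_power_dvd_all p_power_dvd_iff by blast
  have X: "\<not> ?p ^ m dvd residue x (m + n)" using m residue_le[of m "m + n" x] by auto
  have Y: "\<not> ?p ^ n dvd residue y (m + n)" using n residue_le[of n "m + n" y] by auto
  show "x * y \<noteq> 0"
  proof
    assume "x * y = 0"
    then have "residue (x * y) (m + n) = 0" by (simp add: zero_padic_int.rep_eq)
    then have D: "?p ^ (m + n) dvd residue x (m + n) * residue y (m + n)"
      by (auto simp: times_padic_int.rep_eq)
    have nz: "residue x (m + n) \<noteq> 0" "residue y (m + n) \<noteq> 0" using X Y by auto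
    have "m + n \<le> multiplicity ?p (residue x (m + n) * residue y (m + n))"
      using D nz prime by (intro multiplicity_geI) auto
    also have "\<dots> = multiplicity ?p (residue x (m + n)) + multiplicity ?p (residue y (m + n))"
      using nz prime by (intro prime_elem_multiplicity_mult_distrib) auto
    finally have "m \<le> multiplicity ?p (residue x (m + n)) \<or> n \<le> multiplicity ?p (residue y (m + n))"
      by linarith
    with X Y show False using multiplicity_dvd' by blast
  qed
qed

instance padic_int :: (prime_card) ring_char_0
proof
  show "inj (of_nat :: nat \<Rightarrow> 'a padic_int)"
  proof (rule injI, rule ccontr)
    fix k l :: nat
    assume eq: "(of_nat k :: 'a padic_int) = of_nat l" and "k \<noteq> l"
    define n where "n = k + l"
    have "n < CARD('a) ^ n" using CARD_prime_card_gt_1[where ?'p = 'a] by (simp add: power_gt_expt)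
    then have "k < CARD('a) ^ n" "l < CARD('a) ^ n" by (auto simp: n_def)
    moreover have "int (k mod CARD('a) ^ n) = int (l mod CARD('a) ^ n)"
      using arg_cong[OF eq, of "\<lambda>x. residue x n"] by (simp add: residue_of_nat zmod_int)
    ultimately show False using \<open>k \<noteq> l\<close> by simp
  qed
qed

text \<open>Division is the exact quotient where there is one; elsewhere its value is irrelevant.\<close>

instantiation padic_int :: (prime_card) idom_divide
begin

definition divide_padic_int :: "'a padic_int \<Rightarrow> 'a padic_int \<Rightarrow> 'a padic_int" where
  "divide_padic_int x y = (if y \<noteq> 0 \<and> y dvd x then (THE z. x = z * y) else 0)"

instance
proof
  fix a b :: "'a padic_int"
  assume "b \<noteq> 0"
  then have "(THE z. a * b = z * b) = a" by (intro the_equality) auto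
  with \<open>b \<noteq> 0\<close> show "a * b div b = a" by (simp add: divide_padic_int_def)
qed (simp add: divide_padic_int_def)

end

lemma padic_complete:
  fixes c :: "nat \<Rightarrow> 'p::prime_card padic_int"
  assumes "\<And>e. of_nat CARD('p) ^ e dvd c (Suc e) - c e"
  obtains l where "\<And>e. of_nat CARD('p) ^ e dvd l - c e"
proof -
  define f where "f e = residue (c e) e" for e
  have "f e = f (Suc e) mod int CARD('p) ^ e" for e
    using assms[of e] residue_Suc[of "c (Suc e)" e] unfolding f_def p_power_dvd_diff_iff by simp
  then have "residue (Abs_padic_int f :: 'p padic_int) = f"
    by (rule residue_Abs_padic_int)
  then have "of_nat CARD('p) ^ e dvd (Abs_padic_int f :: 'p padic_int) - c e" for e
    by (simp add: p_power_dvd_diff_iff f_def)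
  then show ?thesis using that by blast
qed

text \<open>The p-adic topology.\<close>

instantiation padic_int :: (prime_card) t2_space
begin

definition open_padic_int :: "'a padic_int set \<Rightarrow> bool" where
  "open_padic_int U \<longleftrightarrow> (\<forall>x\<in>U. \<exists>n. \<forall>y. of_nat CARD('a) ^ n dvd y - x \<longrightarrow> y \<in> U)"

lemma open_padic_coset: "open {y :: 'a padic_int. of_nat CARD('a) ^ n dvd y - x}"
  unfolding open_padic_int_def
proof (intro ballI exI allI impI)
  fix y z :: "'a padic_int"
  assume "y \<in> {y. of_nat CARD('a) ^ n dvd y - x}" "of_nat CARD('a) ^ n dvd z - y"
  then have "of_nat CARD('a) ^ n dvd (z - y) + (y - x)" by (intro dvd_add) auto
  then show "z \<in> {y. of_nat CARD('a) ^ n dvd y - x}" by simp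
qed

instance
proof
  show "open (UNIV :: 'a padic_int set)" by (simp add: open_padic_int_def)
  fix S T :: "'a padic_int set"
  assume ST: "open S" "open T"
  show "open (S \<inter> T)"
    unfolding open_padic_int_def
  proof
    fix x assume "x \<in> S \<inter> T"
    with ST obtain m n where
      mn: "\<And>y. of_nat CARD('a) ^ m dvd y - x \<Longrightarrow> y \<in> S" "\<And>y. of_nat CARD('a) ^ n dvd y - x \<Longrightarrow> y \<in> T"
      unfolding open_padic_int_def by blast
    have "y \<in> S \<inter> T" if "of_nat CARD('a) ^ (m + n) dvd y - x" for y
      using mn[of y] that by (auto simp: power_add dest: dvd_mult_left dvd_mult_right)
    then show "\<exists>n. \<forall>y. of_nat CARD('a) ^ n dvd y - x \<longrightarrow> y \<in> S \<inter> T" by blast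
  qed
next
  fix K :: "'a padic_int set set"
  assume "\<forall>S\<in>K. open S"
  then show "open (\<Union>K)" unfolding open_padic_int_def by (meson UnionE UnionI)
next
  fix x y :: "'a padic_int"
  assume "x \<noteq> y"
  then obtain n where n: "\<not> of_nat CARD('a) ^ n dvd x - y" using p_power_dvd_all[of "x - y"] by auto
  have "{z. of_nat CARD('a) ^ n dvd z - x} \<inter> {z. of_nat CARD('a) ^ n dvd z - y} = {}"
    using n unfolding p_power_dvd_diff_iff by auto
  then show "\<exists>U V. open U \<and> open V \<and> x \<in> U \<and> y \<in> V \<and> U \<inter> V = {}"
    using open_padic_coset[of n x] open_padic_coset[of n y] by (intro exI conjI) auto
qed

end

lemma tendsto_padic_int_iff:
  "(f \<longlongrightarrow> (l :: 'p::prime_card padic_int)) F \<longleftrightarrow> (\<forall>n. \<forall>\<^sub>F x in F. of_nat CARD('p) ^ n dvd f x - l)"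
proof
  assume "(f \<longlongrightarrow> l) F"
  then show "\<forall>n. \<forall>\<^sub>F x in F. of_nat CARD('p) ^ n dvd f x - l"
    using topological_tendstoD[OF _ open_padic_coset[of _ l]] by fastforce
next
  assume *: "\<forall>n. \<forall>\<^sub>F x in F. of_nat CARD('p) ^ n dvd f x - l"
  show "(f \<longlongrightarrow> l) F"
  proof (rule topological_tendstoI)
    fix S assume "open S" "l \<in> S"
    then obtain n where "\<And>y. of_nat CARD('p) ^ n dvd y - l \<Longrightarrow> y \<in> S"
      unfolding open_padic_int_def by blast
    with * show "\<forall>\<^sub>F x in F. f x \<in> S" by (metis (mono_tags, lifting) eventually_mono)
  qed
qed

section \<open>The p-adic numbers and integers in the statement\<close>

definition padic_alpha :: "nat \<Rightarrow> nat \<Rightarrow> 'p::prime_card padic_int" where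
  "padic_alpha a b = (\<Sum>j. of_nat ((a + b) div 2) * of_nat CARD('p) ^ j)"

lemma padic_alpha_closed_form:
  assumes "even (a + b)"
  shows "2 * (1 - of_nat CARD('p)) * padic_alpha a b = (of_nat (a + b) :: 'p::prime_card padic_int)"
proof -
  let ?p = "of_nat CARD('p) :: 'p padic_int" and ?c = "of_nat ((a + b) div 2) :: 'p padic_int"
  define S where "S n = (\<Sum>j<n. ?c * ?p ^ j)" for n
  obtain l where l: "\<And>n. ?p ^ n dvd l - S n"
    by (rule padic_complete[of S]) (auto simp: S_def)
  have "S \<longlonglongrightarrow> l"
    unfolding tendsto_padic_int_iff
  proof
    fix n
    have "?p ^ n dvd S m - l" if "n \<le> m" for m
      using l[of m] le_imp_power_dvd[OF that, of ?p] by (metis dvd_trans dvd_minus_iff minus_diff_eq)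
    then show "\<forall>\<^sub>F m in sequentially. ?p ^ n dvd S m - l"
      unfolding eventually_sequentially by blast
  qed
  then have "(\<lambda>j. ?c * ?p ^ j) sums l" unfolding sums_def S_def[abs_def] .
  then have l_eq: "padic_alpha a b = l" by (simp add: padic_alpha_def sums_unique[symmetric])
  have S: "(1 - ?p) * S n = ?c - ?c * ?p ^ n" for n
  proof (induction n)
    case (Suc n)
    have "(1 - ?p) * S (Suc n) = (1 - ?p) * S n + (1 - ?p) * (?c * ?p ^ n)"
      by (simp add: S_def distrib_left)
    then show ?case unfolding Suc by (simp add: algebra_simps)
  qed (simp add: S_def)
  have "(1 - ?p) * l - ?c = 0"
  proof (rule p_power_dvd_all)
    fix n
    have "(1 - ?p) * l - ?c = (1 - ?p) * (l - S n) - ?c * ?p ^ n"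
      by (simp add: right_diff_distrib S)
    then show "?p ^ n dvd (1 - ?p) * l - ?c" using l[of n] by simp
  qed
  moreover have "2 * ?c = of_nat (a + b)"
    using assms by (metis dvd_mult_div_cancel of_nat_mult of_nat_numeral)
  ultimately show ?thesis unfolding l_eq by (simp only: mult.assoc right_minus_eq)
qed

text \<open>
  The integer with \<open>s\<close> base-\<open>p\<close> digits, the \<open>j\<close>-th of which is \<open>b\<close> or \<open>a\<close> according to whether the
  \<open>j\<close>-th binary digit of \<open>r\<close> is \<open>1\<close> or \<open>0\<close>.  The subtraction is on natural numbers and is
  only meant for \<open>a \<le> b\<close>.
\<close>

definition digit_number :: "nat \<Rightarrow> nat \<Rightarrow> nat \<Rightarrow> nat \<Rightarrow> nat \<Rightarrow> nat" where
  "digit_number p a b s r = (\<Sum>j<s. ((b - a) * of_bool (bit r j) + a) * p ^ j)"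

lemma even_digit_number: "even a \<Longrightarrow> even b \<Longrightarrow> even (digit_number p a b s r)"
  unfolding digit_number_def by (intro dvd_sum) simp

text \<open>The division is exact, see \<open>fact_mult_padic_binomial\<close> below.\<close>

definition padic_binomial :: "'p::prime_card padic_int \<Rightarrow> nat \<Rightarrow> 'p padic_int" where
  "padic_binomial x k = (\<Prod>i<k. x - of_nat i) div fact k"

lemma fact_mult_binomial: "fact k * of_nat (n choose k) = (\<Prod>i<k. of_nat n - of_nat i :: 'a::{idom,ring_char_0})"
proof (induction k)
  case (Suc k)
  have "Suc k * (n choose Suc k) = (n - k) * (n choose k)"
    by (simp only: binomial_absorption binomial_absorb_comp)
  then have "of_nat (Suc k) * of_nat (n choose Suc k) = (of_nat (n - k) * of_nat (n choose k) :: 'a)"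
    by (simp only: of_nat_mult[symmetric])
  also have "\<dots> = (of_nat n - of_nat k) * of_nat (n choose k)"
    by (cases "k \<le> n") (simp_all add: of_nat_diff binomial_eq_0)
  finally have "fact (Suc k) * of_nat (n choose Suc k) = (of_nat n - of_nat k) * (fact k * of_nat (n choose k) :: 'a)"
    by (simp only: fact_Suc mult_ac)
  then show ?case using Suc by (simp add: mult.commute)
qed simp

lemma padic_binomial_of_nat: "padic_binomial (of_nat n) k = of_nat (n choose k)"
  unfolding padic_binomial_def fact_mult_binomial[symmetric] by simp


lemma coprime_p_power_dvd_mult:
  assumes "coprime w CARD('p)" "of_nat CARD('p) ^ e dvd of_nat w * (y :: 'p::prime_card padic_int)"
  shows "of_nat CARD('p) ^ e dvd y"
proof -
  have "int CARD('p) ^ e dvd int w * residue y e"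
    using assms(2) by (simp add: p_power_dvd_iff times_padic_int.rep_eq residue_of_nat mod_mult_left_eq dvd_eq_mod_eq_0)
  moreover have "coprime (int CARD('p) ^ e) (int w)"
    using assms(1) by (simp add: coprime_commute)
  ultimately have "int CARD('p) ^ e dvd residue y e" by (simp add: coprime_dvd_mult_right_iff)
  then show ?thesis using residue_mod[of y e] by (simp add: p_power_dvd_iff)
qed

lemma dvd_prod_diff:
  fixes f g :: "nat \<Rightarrow> 'a::comm_ring_1"
  assumes "\<And>i. d dvd f i - g i"
  shows "d dvd prod f {..<k} - prod g {..<k}"
proof (induction k)
  case (Suc k)
  have "prod f {..<Suc k} - prod g {..<Suc k} =
      (prod f {..<k} - prod g {..<k}) * f k + prod g {..<k} * (f k - g k)"
    by (simp add: algebra_simps)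
  with Suc assms[of k] show ?case by simp
qed simp

lemma fact_mult_padic_binomial:
  "fact k * padic_binomial x k = (\<Prod>i<k. x - of_nat i :: 'p::prime_card padic_int)"
proof -
  let ?p = "of_nat CARD('p) :: 'p padic_int"
  define X where "X = (\<Prod>i<k. x - of_nat i :: 'p padic_int)"
  define B where "B e = (of_nat (nat (residue x e) choose k) :: 'p padic_int)" for e
  have B: "?p ^ e dvd X - fact k * B e" for e
  proof -
    have "X - fact k * B e = (\<Prod>i<k. x - of_nat i) - (\<Prod>i<k. of_nat (nat (residue x e)) - of_nat i)"
      unfolding X_def B_def fact_mult_binomial ..
    also have "?p ^ e dvd \<dots>"
      by (rule dvd_prod_diff) (use p_power_dvd_diff_residue[of e x] in simp)
    finally show ?thesis .
  qed
  have prime: "prime CARD('p)" by (rule prime_card)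
  obtain w where w: "fact k = CARD('p) ^ multiplicity CARD('p) (fact k :: nat) * w" "coprime w CARD('p)"
  proof -
    obtain w where "fact k = CARD('p) ^ multiplicity CARD('p) (fact k :: nat) * w" "\<not> CARD('p) dvd w"
      using multiplicity_decompose'[of "fact k :: nat" "CARD('p)"] prime_gt_1_nat[OF prime] by (metis fact_nonzero less_irrefl nat_dvd_1_iff_1)
    moreover from this have "coprime w CARD('p)"
      using prime by (metis prime_imp_coprime coprime_commute)
    ultimately show ?thesis using that by blast
  qed
  define v where "v = multiplicity CARD('p) (fact k :: nat)"
  have fact: "fact k = ?p ^ v * of_nat w"
    using arg_cong[OF w(1), of "of_nat :: nat \<Rightarrow> 'p padic_int"] by (simp add: v_def)
  have nz: "?p ^ v \<noteq> 0" using CARD_prime_card_gt_1[where ?'p = 'p] by simp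
  define c where "c e = B (e + v)" for e
  have "?p ^ e dvd c (Suc e) - c e" for e
  proof -
    have "?p ^ (e + v) dvd X - fact k * B (Suc e + v)"
      using B[of "Suc e + v"] by (rule dvd_trans[rotated]) (simp add: le_imp_power_dvd)
    then have "?p ^ (e + v) dvd (X - fact k * B (e + v)) - (X - fact k * B (Suc e + v))"
      using B[of "e + v"] by (rule dvd_diff[rotated])
    then have "?p ^ v * ?p ^ e dvd ?p ^ v * (of_nat w * (c (Suc e) - c e))"
      by (simp add: fact c_def algebra_simps power_add)
    then have "?p ^ e dvd of_nat w * (c (Suc e) - c e)" using nz by simp
    then show ?thesis by (rule coprime_p_power_dvd_mult[OF w(2)])
  qed
  then obtain l where l: "\<And>e. ?p ^ e dvd l - c e" by (rule padic_complete) blast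
  have "X - fact k * l = 0"
  proof (rule p_power_dvd_all)
    fix e
    have "?p ^ e dvd X - fact k * B (e + v)"
      using B[of "e + v"] by (rule dvd_trans[rotated]) (simp add: le_imp_power_dvd)
    then have "?p ^ e dvd (X - fact k * B (e + v)) - fact k * (l - c e)"
      using dvd_mult[OF l[of e]] by (rule dvd_diff)
    then show "?p ^ e dvd X - fact k * l" by (simp add: c_def algebra_simps)
  qed
  then have "X = fact k * l" by simp
  then show ?thesis unfolding padic_binomial_def X_def[symmetric] by simp
qed


section \<open>Gaussian binomial coefficients\<close>

text \<open>The indeterminate \<open>q\<close> is \<open>monom 1 1\<close>; the divisions are exact.\<close>

definition q_int :: "nat \<Rightarrow> int poly" where
  "q_int n = (1 - monom 1 n) div (1 - monom 1 1)"

definition q_fact :: "nat \<Rightarrow> int poly" where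
  "q_fact n = (\<Prod>j=1..n. q_int j)"

definition q_binomial :: "nat \<Rightarrow> nat \<Rightarrow> int poly" where
  "q_binomial n k = (if k \<le> n then q_fact n div (q_fact k * q_fact (n - k)) else 0)"

lemma one_minus_monom_nonzero: "0 < n \<Longrightarrow> (1 - monom 1 n :: int poly) \<noteq> 0"
  by (metis coeff_monom degree_1 degree_monom_eq eq_iff_diff_eq_0 less_irrefl zero_neq_one)

lemma q_int_eq_sum: "q_int n = (\<Sum>j<n. monom 1 j)"
proof -
  have "(\<Sum>j<n. monom 1 j) * (1 - monom 1 1) = (1 - monom 1 n :: int poly)"
    by (induction n) (simp_all add: distrib_right right_diff_distrib mult_monom)
  then show ?thesis unfolding q_int_def
    by (metis nonzero_mult_div_cancel_right one_minus_monom_nonzero zero_less_one)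
qed

lemma q_int_mult: "q_int n * (1 - monom 1 1) = 1 - monom 1 n"
  unfolding q_int_eq_sum
  by (induction n) (simp_all add: distrib_right right_diff_distrib mult_monom)

lemma q_int_add: "q_int (m + n) = q_int m + monom 1 m * q_int n"
  unfolding q_int_eq_sum by (induction n) (simp_all add: algebra_simps mult_monom)

lemma q_int_nonzero: "0 < n \<Longrightarrow> q_int n \<noteq> 0"
  using q_int_mult[of n] one_minus_monom_nonzero[of n] by auto

lemma q_fact_nonzero: "q_fact n \<noteq> 0"
  unfolding q_fact_def by (simp add: q_int_nonzero)

lemma q_fact_Suc: "q_fact (Suc n) = q_int (Suc n) * q_fact n"
  unfolding q_fact_def by (simp add: mult.commute)

fun gauss_pascal :: "nat \<Rightarrow> nat \<Rightarrow> int poly" where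
  "gauss_pascal n 0 = 1"
| "gauss_pascal 0 (Suc k) = 0"
| "gauss_pascal (Suc n) (Suc k) = gauss_pascal n k + monom 1 (Suc k) * gauss_pascal n (Suc k)"

lemma gauss_pascal_eq_0: "n < k \<Longrightarrow> gauss_pascal n k = 0"
  by (induction n k rule: gauss_pascal.induct) auto

lemma gauss_pascal_fact: "k \<le> n \<Longrightarrow> gauss_pascal n k * (q_fact k * q_fact (n - k)) = q_fact n"
proof (induction n k rule: gauss_pascal.induct)
  case (1 n)
  show ?case by (simp add: q_fact_def)
next
  case (3 n k)
  then have IH1: "gauss_pascal n k * (q_fact k * q_fact (n - k)) = q_fact n" by simp
  have A: "gauss_pascal n k * (q_fact (Suc k) * q_fact (n - k)) = q_int (Suc k) * q_fact n"
    unfolding IH1[symmetric] q_fact_Suc by (simp only: mult_ac)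
  have B: "gauss_pascal n (Suc k) * (q_fact (Suc k) * q_fact (n - k)) = q_int (n - k) * q_fact n"
  proof (cases "k < n")
    case True
    then have IH2: "gauss_pascal n (Suc k) * (q_fact (Suc k) * q_fact (n - Suc k)) = q_fact n"
      using 3 by simp
    have "n - k = Suc (n - Suc k)" using True by simp
    then have "q_fact (n - k) = q_int (n - k) * q_fact (n - Suc k)" using q_fact_Suc by metis
    then show ?thesis unfolding IH2[symmetric] by (simp only: mult_ac)
  next
    case False
    then show ?thesis using 3 by (simp add: gauss_pascal_eq_0 q_int_def)
  qed
  have "gauss_pascal (Suc n) (Suc k) * (q_fact (Suc k) * q_fact (Suc n - Suc k)) =
      gauss_pascal n k * (q_fact (Suc k) * q_fact (n - k)) +
      monom 1 (Suc k) * (gauss_pascal n (Suc k) * (q_fact (Suc k) * q_fact (n - k)))"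
    by (simp add: distrib_right mult.assoc)
  also have "\<dots> = (q_int (Suc k) + monom 1 (Suc k) * q_int (n - k)) * q_fact n"
    unfolding A B by (simp only: distrib_right mult.assoc)
  also have "q_int (Suc k) + monom 1 (Suc k) * q_int (n - k) = q_int (Suc n)"
    using 3 by (simp add: q_int_add[symmetric])
  finally show ?case by (simp only: q_fact_Suc)
qed simp

lemma q_binomial_eq_gauss_pascal: "q_binomial n k = gauss_pascal n k"
proof (cases "k \<le> n")
  case True
  have "q_fact k * q_fact (n - k) \<noteq> 0" by (simp add: q_fact_nonzero)
  with True show ?thesis
    unfolding q_binomial_def by (simp add: gauss_pascal_fact[OF True, symmetric])
qed (simp add: q_binomial_def gauss_pascal_eq_0)

lemma q_binomial_fact: "k \<le> n \<Longrightarrow> q_binomial n k * (q_fact k * q_fact (n - k)) = q_fact n"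
  by (simp add: q_binomial_eq_gauss_pascal gauss_pascal_fact)

lemma q_binomial_0_right: "q_binomial n 0 = 1"
  by (simp add: q_binomial_eq_gauss_pascal)

lemma q_binomial_0_left: "q_binomial 0 (Suc k) = 0"
  by (simp add: q_binomial_eq_gauss_pascal)

lemma q_binomial_Suc:
  "q_binomial (Suc n) (Suc k) = q_binomial n k + monom 1 (Suc k) * q_binomial n (Suc k)"
  by (simp add: q_binomial_eq_gauss_pascal)

section \<open>Cyclotomic polynomials\<close>

text \<open>\<open>cyclotomic n\<close> is the integer polynomial whose complex factorization runs over the primitive
  \<open>n\<close>-th roots of unity; for prime powers its existence is part of \<open>cyclotomic_prime_power\<close>.\<close>

definition primitive_roots :: "nat \<Rightarrow> complex set" where
  "primitive_roots n = {z. z ^ n = 1 \<and> (\<forall>d. 0 < d \<and> d < n \<longrightarrow> z ^ d \<noteq> 1)}"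

definition cyclotomic :: "nat \<Rightarrow> int poly" where
  "cyclotomic n = (THE f. of_int_poly f = (\<Prod>z\<in>primitive_roots n. [:- z, 1:]))"

lemma prod_roots_unity:
  assumes "0 < n"
  shows "(\<Prod>z | z ^ n = 1. [:- z, 1:]) = (monom 1 n - 1 :: complex poly)"
proof -
  let ?f = "monom 1 n - 1 :: complex poly"
  have "rsquarefree ?f"
    unfolding rsquarefree_roots
  proof (intro allI notI)
    fix z assume z: "poly ?f z = 0 \<and> poly (pderiv ?f) z = 0"
    then have "z ^ n = 1" by (simp add: poly_monom)
    then have "z \<noteq> 0" using assms by (auto simp: power_0_left)
    with z assms show False by (simp add: pderiv_diff pderiv_monom poly_monom)
  qed
  moreover have "degree ?f = n"
  proof (rule antisym)
    show "degree ?f \<le> n" by (intro degree_diff_le) (auto simp: degree_monom_le)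
    show "n \<le> degree ?f" using assms by (intro le_degree) simp
  qed
  then have "lead_coeff ?f = 1" using assms by simp
  ultimately show ?thesis using complex_poly_decompose_rsquarefree[of ?f] by (simp add: poly_monom)
qed

lemma finite_roots_unity: "0 < n \<Longrightarrow> finite {z :: complex. z ^ n = 1}"
  by (rule finite_roots_unity) simp

lemma sum_monom_telescope:
  "(\<Sum>j<k. monom 1 (j * l)) * (monom 1 l - 1) = (monom 1 (k * l) - 1 :: 'a::comm_ring_1 poly)"
proof (induction k)
  case (Suc k)
  have "(\<Sum>j<Suc k. monom 1 (j * l)) * (monom 1 l - 1) =
      (\<Sum>j<k. monom 1 (j * l)) * (monom 1 l - 1) + monom 1 (k * l) * (monom 1 l - 1 :: 'a poly)"
    by (simp add: distrib_right)
  then show ?case unfolding Suc by (simp add: right_diff_distrib mult_monom add.commute)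
qed simp

lemma primitive_roots_prime_power:
  assumes "prime p" "0 < m"
  shows "primitive_roots (p ^ m) = {z. z ^ (p ^ m) = 1} - {z. z ^ (p ^ (m - 1)) = 1}"
proof -
  have p: "p > 1" using assms(1) by (rule prime_gt_1_nat)
  have less: "p ^ (m - 1) < p ^ m" using p assms(2) by (intro power_strict_increasing) auto
  have "z ^ (p ^ (m - 1)) = 1" if z: "z ^ (p ^ m) = 1" "0 < d" "d < p ^ m" "z ^ d = 1" for z :: complex and d
  proof -
    define e where "e = (LEAST e. 0 < e \<and> z ^ e = 1)"
    have e: "0 < e" "z ^ e = 1" "e \<le> d"
      using LeastI[of "\<lambda>e. 0 < e \<and> z ^ e = 1" d] Least_le[of "\<lambda>e. 0 < e \<and> z ^ e = 1" d] z
      by (auto simp: e_def)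
    have "z ^ (p ^ m mod e) = 1"
    proof -
      have "z ^ (p ^ m) = z ^ (e * (p ^ m div e) + p ^ m mod e)" by simp
      also have "\<dots> = (z ^ e) ^ (p ^ m div e) * z ^ (p ^ m mod e)"
        by (simp only: power_add power_mult)
      finally show ?thesis using z e by simp
    qed
    moreover have "p ^ m mod e < e" using e by simp
    ultimately have "p ^ m mod e = 0"
      using not_less_Least[of "p ^ m mod e" "\<lambda>e. 0 < e \<and> z ^ e = 1"] by (auto simp: e_def)
    then obtain k where k: "e = p ^ k" using divides_primepow_nat[OF assms(1)] by (auto simp: dvd_eq_mod_eq_0)
    with e z have "p ^ k < p ^ m" by linarith
    then have "k \<le> m - 1" using p by (simp add: power_strict_increasing_iff)
    then have "e dvd p ^ (m - 1)" by (simp add: k le_imp_power_dvd)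
    then show ?thesis using e by (auto simp: power_mult)
  qed
  moreover have "0 < p ^ (m - 1)" using p by simp
  ultimately show ?thesis using less unfolding primitive_roots_def by blast
qed

lemma cyclotomic_prime_power:
  assumes "prime p" "0 < m"
  shows "cyclotomic (p ^ m) = (\<Sum>j<p. monom 1 (j * p ^ (m - 1)))"
proof -
  let ?f = "\<Sum>j<p. monom 1 (j * p ^ (m - 1)) :: int poly"
  have p: "p > 1" using assms(1) by (rule prime_gt_1_nat)
  have pm: "p * p ^ (m - 1) = p ^ m" using assms(2) by (cases m) auto
  let ?A = "{z :: complex. z ^ (p ^ m) = 1}" and ?B = "{z :: complex. z ^ (p ^ (m - 1)) = 1}"
  have BA: "?B \<subseteq> ?A" by (auto simp: pm[symmetric] power_mult mult.commute[of p])
  have fin: "finite ?A" using p by (intro finite_roots_unity) simp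
  have "(\<Prod>z\<in>primitive_roots (p ^ m). [:- z, 1:]) * (monom 1 (p ^ (m - 1)) - 1) = (monom 1 (p ^ m) - 1 :: complex poly)"
    using prod.subset_diff[OF BA fin, of "\<lambda>z. [:- z, 1:]"] p
    by (simp add: primitive_roots_prime_power[OF assms] prod_roots_unity)
  also have "\<dots> = (\<Sum>j<p. monom 1 (j * p ^ (m - 1))) * (monom 1 (p ^ (m - 1)) - 1)"
    unfolding sum_monom_telescope pm ..
  finally have "(\<Prod>z\<in>primitive_roots (p ^ m). [:- z, 1:]) = (\<Sum>j<p. monom 1 (j * p ^ (m - 1)) :: complex poly) \<or>
      monom 1 (p ^ (m - 1)) - 1 = (0 :: complex poly)"
    by (metis mult_cancel_right)
  moreover have "monom 1 (p ^ (m - 1)) - 1 \<noteq> (0 :: complex poly)"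
  proof
    assume "monom 1 (p ^ (m - 1)) - 1 = (0 :: complex poly)"
    then have "coeff (monom 1 (p ^ (m - 1)) - 1 :: complex poly) 0 = 0" by (simp only: coeff_0)
    with p show False by simp
  qed
  ultimately have eq: "of_int_poly ?f = (\<Prod>z\<in>primitive_roots (p ^ m). [:- z, 1:])"
    by (simp add: of_int_poly_hom.hom_sum)
  show ?thesis
    unfolding cyclotomic_def
  proof (rule the_equality)
    show "of_int_poly ?f = (\<Prod>z\<in>primitive_roots (p ^ m). [:- z, 1:])" by (rule eq)
    fix g :: "int poly"
    assume "of_int_poly g = (\<Prod>z\<in>primitive_roots (p ^ m). [:- z, 1:])"
    then have "(of_int_poly g :: complex poly) = of_int_poly ?f" using eq by simp
    then show "g = ?f" by (rule of_int_poly_hom.injectivity)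
  qed
qed

lemma cyclotomic_mult_q_int:
  assumes "prime p" "0 < m"
  shows "cyclotomic (p ^ m) * q_int (p ^ (m - 1)) = q_int (p ^ m)"
proof -
  have pm: "p * p ^ (m - 1) = p ^ m" using assms(2) by (cases m) auto
  have "(cyclotomic (p ^ m) * q_int (p ^ (m - 1))) * (1 - monom 1 1) =
      - ((\<Sum>j<p. monom 1 (j * p ^ (m - 1))) * (monom 1 (p ^ (m - 1)) - 1))"
    unfolding mult.assoc q_int_mult cyclotomic_prime_power[OF assms]
    by (simp only: mult_minus_right[symmetric] minus_diff_eq)
  also have "\<dots> = q_int (p ^ m) * (1 - monom 1 1)"
    unfolding sum_monom_telescope pm q_int_mult by simp
  finally show ?thesis using one_minus_monom_nonzero[of 1] by simp
qed

lemma q_int_dvd: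
  assumes "m dvd n" shows "q_int m dvd q_int n"
proof -
  obtain k where n: "n = m * k" using assms ..
  have "q_int m dvd q_int (m * k)"
  proof (induction k)
    case 0
    show ?case by (simp add: q_int_eq_sum)
  next
    case (Suc k)
    then show ?case by (simp only: mult_Suc_right q_int_add) simp
  qed
  then show ?thesis by (simp add: n)
qed

lemma cyclotomic_dvd_q_int:
  assumes "prime p" "1 \<le> m" "m \<le> n"
  shows "cyclotomic (p ^ m) dvd q_int (p ^ n)"
  using cyclotomic_mult_q_int[of p m] q_int_dvd[of "p ^ m" "p ^ n"] assms
  by (metis dvd_mult_left le_imp_power_dvd less_eq_Suc_le One_nat_def)

lemma monic_sum_monom:
  assumes "0 < l" "1 < k"
  shows "lead_coeff (\<Sum>j<k. monom 1 (j * l) :: int poly) = 1" "0 < degree (\<Sum>j<k. monom 1 (j * l) :: int poly)"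
proof -
  let ?f = "\<Sum>j<k. monom 1 (j * l) :: int poly"
  have 1: "coeff ?f ((k - 1) * l) = 1"
  proof -
    have "coeff ?f ((k - 1) * l) = (\<Sum>j<k. if j = k - 1 then 1 else 0)"
      unfolding coeff_sum using assms by (intro sum.cong) auto
    then show ?thesis using assms by simp
  qed
  have "degree ?f \<le> (k - 1) * l"
    by (intro degree_sum_le order.trans[OF degree_monom_le]) auto
  then have d: "degree ?f = (k - 1) * l" using 1 by (intro antisym le_degree) auto
  show "lead_coeff ?f = 1" unfolding d by (rule 1)
  show "0 < degree ?f" unfolding d using assms by simp
qed

lemma monic_cyclotomic:
  assumes "prime p" "1 \<le> m"
  shows "lead_coeff (cyclotomic (p ^ m)) = 1" "0 < degree (cyclotomic (p ^ m))"
  using assms prime_gt_1_nat[OF assms(1)] monic_sum_monom[of "p ^ (m - 1)" p]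
  by (simp_all add: cyclotomic_prime_power)

lemma monic_q_int:
  assumes "1 < n"
  shows "lead_coeff (q_int n) = 1" "0 < degree (q_int n)"
  using monic_sum_monom[of 1 n] assms by (simp_all add: q_int_eq_sum)

section \<open>Gaussian binomial coefficients with a p-adic upper argument\<close>

text \<open>
  For \<open>x\<close> in \<open>\<int>\<^sub>p\<close> the coefficient with upper argument \<open>x\<close> is the limit of the coefficients with
  upper arguments the natural numbers \<open>N\<close> tending \<open>p\<close>-adically to \<open>x\<close>.  This limit does not exist in
  \<open>\<int>\<^sub>p[q]\<close> itself (for \<open>x = -1\<close> and \<open>k = 1\<close> it would have to be \<open>- 1 / q\<close>), but it does in
  \<open>\<int>\<^sub>p[q] / (P)\<close>, with its \<open>p\<close>-adic topology, for every monic divisor \<open>P\<close> of some \<open>[p ^ n]\<close>.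
  If \<open>P\<close> is the \<open>p ^ m\<close>-th cyclotomic polynomial, this ring is \<open>\<int>\<^sub>p[\<zeta>]\<close> with \<open>\<zeta>\<close> a primitive
  \<open>p ^ m\<close>-th root of unity, and one obtains the continuous extension over \<open>\<rat>\<^sub>p[\<zeta>]\<close>.

  Hence \<open>padic_q_binomial P x k\<close> is the element of \<open>\<int>\<^sub>p[q]\<close> of degree less than that of \<open>P\<close> which
  represents the limit modulo \<open>P\<close>.  It is only meant to be used in congruences modulo \<open>P\<close>, for
  which the choice of the representative is irrelevant.  It exists and is unique
  (\<open>padic_q_binomial_characterization\<close>), extends the coefficients with natural upper argument
  (\<open>padic_q_binomial_of_nat\<close>), is continuous (\<open>padic_q_binomial_continuous\<close>), and the values for
  different moduli are compatible (\<open>padic_q_binomial_dvd_modulus\<close>).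

  \<open>cong_mod_ideal P e\<close> is congruence modulo the ideal generated by \<open>P\<close> and \<open>p ^ e\<close>.
\<close>

definition cong_mod_ideal ::
  "'p::prime_card padic_int poly \<Rightarrow> nat \<Rightarrow> 'p padic_int poly \<Rightarrow> 'p padic_int poly \<Rightarrow> bool" where
  "cong_mod_ideal P e f g \<longleftrightarrow> (\<exists>u v. f - g = P * u + of_nat CARD('p) ^ e * v)"

definition q_binomial_tendsto ::
  "'p::prime_card padic_int poly \<Rightarrow> 'p padic_int \<Rightarrow> nat \<Rightarrow> 'p padic_int poly \<Rightarrow> bool" where
  "q_binomial_tendsto P x k f \<longleftrightarrow>
    (\<forall>e. \<exists>d. \<forall>n. of_nat CARD('p) ^ d dvd of_nat n - x \<longrightarrow> cong_mod_ideal P e (of_int_poly (q_binomial n k)) f)"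

definition padic_q_binomial ::
  "'p::prime_card padic_int poly \<Rightarrow> 'p padic_int \<Rightarrow> nat \<Rightarrow> 'p padic_int poly" where
  "padic_q_binomial P x k = (THE f. degree f < degree P \<and> q_binomial_tendsto P x k f)"

lemma cong_mod_ideal_refl: "cong_mod_ideal P e f f"
  unfolding cong_mod_ideal_def by (intro exI[of _ 0]) simp

lemma cong_mod_ideal_add:
  assumes "cong_mod_ideal P e f g" "cong_mod_ideal P e f' g'"
  shows "cong_mod_ideal P e (f + f') (g + g')"
proof -
  obtain u v u' v' where "f - g = P * u + of_nat CARD('a) ^ e * v" "f' - g' = P * u' + of_nat CARD('a) ^ e * v'"
    using assms unfolding cong_mod_ideal_def by blast
  then have "(f + f') - (g + g') = P * (u + u') + of_nat CARD('a) ^ e * (v + v')"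
    by (simp add: distrib_left add_diff_add)
  then show ?thesis unfolding cong_mod_ideal_def by blast
qed

lemma cong_mod_ideal_mult:
  assumes "cong_mod_ideal P e f g"
  shows "cong_mod_ideal P e (h * f) (h * g)"
proof -
  obtain u v where "f - g = P * u + of_nat CARD('a) ^ e * v"
    using assms unfolding cong_mod_ideal_def by blast
  then have "h * f - h * g = P * (h * u) + of_nat CARD('a) ^ e * (h * v)"
    by (simp only: right_diff_distrib[symmetric]) (simp add: distrib_left mult.left_commute)
  then show ?thesis unfolding cong_mod_ideal_def by blast
qed

lemma cong_mod_ideal_sym:
  assumes "cong_mod_ideal P e f g" shows "cong_mod_ideal P e g f"
  using cong_mod_ideal_add[OF cong_mod_ideal_mult[OF assms, of "-1"] cong_mod_ideal_refl[of P e "f + g"]] by simp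

lemma cong_mod_ideal_trans [trans]:
  assumes "cong_mod_ideal P e f g" "cong_mod_ideal P e g h"
  shows "cong_mod_ideal P e f h"
  using cong_mod_ideal_add[OF cong_mod_ideal_add[OF assms] cong_mod_ideal_refl[of P e "- g"]] by simp

lemma cong_mod_ideal_diff_iff: "cong_mod_ideal P e f g \<longleftrightarrow> cong_mod_ideal P e (f - g) 0"
  unfolding cong_mod_ideal_def by simp

lemma cong_mod_ideal_diff:
  assumes "cong_mod_ideal P e f g" "cong_mod_ideal P e f' g'"
  shows "cong_mod_ideal P e (f - f') (g - g')"
  using cong_mod_ideal_add[OF assms(1) cong_mod_ideal_mult[OF assms(2), of "-1"]] by simp

lemma cong_mod_ideal_dvd:
  assumes "P dvd f - g" shows "cong_mod_ideal P e f g"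
proof -
  obtain u where "f - g = P * u + of_nat CARD('a) ^ e * 0" using assms by auto
  then show ?thesis unfolding cong_mod_ideal_def by blast
qed

lemma cong_mod_ideal_p_power: "cong_mod_ideal P e (of_nat CARD('p) ^ e * f) (0 :: 'p::prime_card padic_int poly)"
  unfolding cong_mod_ideal_def by (intro exI[of _ 0] exI[of _ f]) simp

lemma cong_mod_ideal_le:
  assumes "cong_mod_ideal P e f g" "e' \<le> e" shows "cong_mod_ideal P e' f g"
proof -
  obtain u v where "f - g = P * u + of_nat CARD('a) ^ e * v"
    using assms unfolding cong_mod_ideal_def by blast
  moreover have "of_nat CARD('a) ^ e * v = of_nat CARD('a) ^ e' * (of_nat CARD('a) ^ (e - e') * v)"
    using assms(2) by (simp add: mult.assoc[symmetric] power_add[symmetric])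
  ultimately show ?thesis unfolding cong_mod_ideal_def by metis
qed

text \<open>Modulo a divisor of \<open>[p ^ n]\<close>, and modulo \<open>p ^ e\<close>, the coefficient is periodic in its upper argument.\<close>

lemma q_binomial_periodic:
  fixes P :: "'p::prime_card padic_int poly"
  assumes P: "P dvd of_int_poly (q_int (CARD('p) ^ n))"
  shows "cong_mod_ideal P e (of_int_poly (q_binomial (N + CARD('p) ^ (n + e * k)) k)) (of_int_poly (q_binomial N k))"
proof (induction k arbitrary: N)
  case 0
  show ?case by (simp add: q_binomial_0_right cong_mod_ideal_refl)
next
  case (Suc k)
  let ?c = "CARD('p)"
  define L where "L = ?c ^ (n + e * k)"
  define Q where "Q i = (monom 1 i :: 'p padic_int poly)" for i
  define G where "G N = (of_int_poly (q_binomial N (Suc k)) :: 'p padic_int poly)" for N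
  define D where "D N = G (N + L) - G N" for N
  have G_Suc: "G (Suc N) = of_int_poly (q_binomial N k) + Q (Suc k) * G N" for N
    by (simp add: G_def Q_def q_binomial_Suc hom_distribs)
  have D_Suc: "cong_mod_ideal P e (D (Suc N)) (Q (Suc k) * D N)" for N
  proof -
    have "D (Suc N) = (of_int_poly (q_binomial (N + L) k) - of_int_poly (q_binomial N k)) + Q (Suc k) * D N"
      by (simp add: D_def G_Suc right_diff_distrib)
    moreover have "cong_mod_ideal P e (of_int_poly (q_binomial (N + L) k) - of_int_poly (q_binomial N k)) 0"
      using Suc.IH[of N] unfolding L_def by (simp only: cong_mod_ideal_diff_iff[symmetric])
    ultimately show ?thesis
      using cong_mod_ideal_add[OF _ cong_mod_ideal_refl, of P e _ 0 "Q (Suc k) * D N"] by simp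
  qed
  have D_add: "cong_mod_ideal P e (D (N + i)) (Q (Suc k * i) * D N)" for N i
  proof (induction i)
    case 0
    show ?case by (simp add: Q_def cong_mod_ideal_refl)
  next
    case (Suc i)
    have "cong_mod_ideal P e (D (N + Suc i)) (Q (Suc k) * D (N + i))" using D_Suc[of "N + i"] by simp
    also have "cong_mod_ideal P e \<dots> (Q (Suc k) * (Q (Suc k * i) * D N))"
      by (rule cong_mod_ideal_mult[OF Suc])
    also have "Q (Suc k) * (Q (Suc k * i) * D N) = Q (Suc k * Suc i) * D N"
      by (simp add: Q_def mult.assoc[symmetric] mult_monom)
    finally show ?case .
  qed
  have D_per: "cong_mod_ideal P e (D (N + j * L)) (D N)" for N j
  proof -
    define M where "M = Suc k * (j * L)"
    have "?c ^ n dvd M" unfolding M_def L_def by (simp add: power_add)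
    then have "of_int_poly (q_int (?c ^ n)) dvd (of_int_poly (q_int M) :: 'p padic_int poly)"
      by (intro of_int_poly_hom.hom_dvd q_int_dvd)
    with P have "P dvd of_int_poly (q_int M)" by (rule dvd_trans)
    then have "P dvd of_int_poly (q_int M) * - of_int_poly (1 - monom 1 1)" by (rule dvd_mult2)
    also have "of_int_poly (q_int M) * - of_int_poly (1 - monom 1 1) = Q M - 1"
    proof -
      have "of_int_poly (q_int M) * of_int_poly (1 - monom 1 1) = (of_int_poly (1 - monom 1 M) :: 'p padic_int poly)"
        by (simp only: q_int_mult of_int_poly_hom.hom_mult[symmetric])
      also have "\<dots> = 1 - Q M" by (simp add: hom_distribs Q_def)
      finally show ?thesis by (simp only: mult_minus_right minus_diff_eq)
    qed
    finally have "cong_mod_ideal P e (Q M) 1" by (rule cong_mod_ideal_dvd)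
    from cong_mod_ideal_mult[OF this, of "D N"] have "cong_mod_ideal P e (Q M * D N) (D N)"
      by (simp add: mult.commute)
    with D_add[of N "j * L"] show ?thesis unfolding M_def by (rule cong_mod_ideal_trans)
  qed
  have G_per: "cong_mod_ideal P e (G (N + j * L)) (G N + of_nat j * D N)" for j
  proof (induction j)
    case 0
    show ?case by (simp add: cong_mod_ideal_refl)
  next
    case (Suc j)
    have "G (N + Suc j * L) = G (N + j * L) + D (N + j * L)" by (simp add: D_def ac_simps)
    moreover have "G N + of_nat (Suc j) * D N = (G N + of_nat j * D N) + D N" by (simp add: algebra_simps)
    ultimately show ?case using cong_mod_ideal_add[OF Suc D_per[of N j]] by (simp only:)
  qed
  have "cong_mod_ideal P e (G N + of_nat (?c ^ e) * D N) (G N + 0)"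
    by (rule cong_mod_ideal_add[OF cong_mod_ideal_refl]) (simp add: cong_mod_ideal_p_power)
  with G_per[of "?c ^ e"] have "cong_mod_ideal P e (G (N + ?c ^ e * L)) (G N)"
    by (metis add_0_right cong_mod_ideal_trans)
  moreover have "?c ^ e * L = ?c ^ (n + e * Suc k)" by (simp add: L_def power_add)
  ultimately show ?case unfolding G_def by simp
qed

lemma q_binomial_cong:
  fixes P :: "'p::prime_card padic_int poly"
  assumes P: "P dvd of_int_poly (q_int (CARD('p) ^ n))"
    and "N mod CARD('p) ^ (n + e * k) = M mod CARD('p) ^ (n + e * k)"
  shows "cong_mod_ideal P e (of_int_poly (q_binomial N k)) (of_int_poly (q_binomial M k))"
proof -
  let ?L = "CARD('p) ^ (n + e * k)"
  have per: "cong_mod_ideal P e (of_int_poly (q_binomial (r + ?L * t) k)) (of_int_poly (q_binomial r k))" for r t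
  proof (induction t)
    case (Suc t)
    have "r + ?L * Suc t = (r + ?L * t) + ?L" by simp
    then show ?case using cong_mod_ideal_trans[OF q_binomial_periodic[OF P, of e "r + ?L * t" k] Suc] by (simp only:)
  qed (simp add: cong_mod_ideal_refl)
  have "cong_mod_ideal P e (of_int_poly (q_binomial N k)) (of_int_poly (q_binomial (N mod ?L) k))" for N
    using per[of "N mod ?L" "N div ?L"] by simp
  from this[of N] this[of M] show ?thesis unfolding assms(2) by (metis cong_mod_ideal_sym cong_mod_ideal_trans)
qed

lemma monic_remainder:
  fixes P f :: "'a::idom poly"
  assumes "lead_coeff P = 1" "0 < degree P"
  obtains h r where "f = P * h + r" "degree r < degree P"
proof -
  have "\<exists>h r. f = P * h + r \<and> degree r < degree P"
  proof (induction "degree f" arbitrary: f rule: less_induct)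
    case less
    show ?case
    proof (cases "degree f < degree P")
      case True
      then show ?thesis by (intro exI[of _ 0] exI[of _ f]) simp
    next
      case False
      define m where "m = monom (lead_coeff f) (degree f - degree P)"
      define g where "g = f - P * m"
      have f0: "lead_coeff f \<noteq> 0" using False assms by auto
      have dm: "degree m = degree f - degree P" unfolding m_def by (rule degree_monom_eq[OF f0])
      have "m \<noteq> 0" using f0 by (simp add: m_def)
      then have dPm: "degree (P * m) = degree f"
        using False assms dm by (subst degree_mult_eq) auto
      have "lead_coeff (P * m) = lead_coeff f"
        unfolding lead_coeff_mult assms(1) using dm by (simp add: m_def)
      then have "coeff g (degree f) = 0" by (simp add: g_def dPm)
      moreover have "degree g \<le> degree f" unfolding g_def by (rule degree_diff_le) (simp_all add: dPm)
      ultimately have "degree g < degree f \<or> g = 0" using f0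
        by (metis le_neq_implies_less leading_coeff_0_iff)
      then have "degree g < degree f" using False assms by auto
      from less[OF this] obtain h r where "g = P * h + r" "degree r < degree P" by blast
      then show ?thesis by (intro exI[of _ "h + m"] exI[of _ r]) (simp add: g_def algebra_simps)
    qed
  qed
  then show ?thesis using that by blast
qed

lemma cong_mod_ideal_degree_less:
  fixes P f g :: "'p::prime_card padic_int poly"
  assumes "lead_coeff P = 1" "0 < degree P" "degree f < degree P" "degree g < degree P"
    and "cong_mod_ideal P e f g"
  shows "of_nat CARD('p) ^ e dvd coeff f i - coeff g i"
proof -
  let ?c = "of_nat (CARD('p) ^ e) :: 'p padic_int"
  obtain u v where uv: "f - g = P * u + of_nat CARD('p) ^ e * v" using assms(5) unfolding cong_mod_ideal_def by blast
  obtain h w where hw: "v = P * h + w" "degree w < degree P" using monic_remainder[OF assms(1,2)] by blast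
  have C: "of_nat CARD('p) ^ e * y = smult ?c y" for y :: "'p padic_int poly"
    using of_nat_poly[of "CARD('p) ^ e", where ?'a = "'p padic_int"] by simp
  have eq: "f - g - smult ?c w = P * (u + smult ?c h)"
    unfolding uv C hw(1) by (simp add: algebra_simps smult_add_right)
  have "degree (f - g - smult ?c w) < degree P"
    using assms(3,4) hw(2) by (intro degree_diff_less) (auto intro: le_less_trans[OF degree_smult_le])
  moreover have "P \<noteq> 0" using assms(2) by auto
  ultimately have "u + smult ?c h = 0"
    unfolding eq by (cases "u + smult ?c h = 0") (auto simp: degree_mult_eq)
  then have "f - g = smult ?c w" using eq by simp
  then have "coeff f i - coeff g i = ?c * coeff w i" by (metis coeff_diff coeff_smult)
  then show ?thesis by simp
qed

lemma q_binomial_tendsto_unique: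
  fixes P f g :: "'p::prime_card padic_int poly"
  assumes "lead_coeff P = 1" "0 < degree P" "degree f < degree P" "degree g < degree P"
    and "q_binomial_tendsto P x k f" "q_binomial_tendsto P x k g"
  shows "f = g"
proof (rule poly_eqI)
  fix i
  have "coeff f i - coeff g i = 0"
  proof (rule p_power_dvd_all)
    fix e
    obtain d d' where
      d: "\<And>n. of_nat CARD('p) ^ d dvd of_nat n - x \<Longrightarrow> cong_mod_ideal P e (of_int_poly (q_binomial n k)) f" and
      d': "\<And>n. of_nat CARD('p) ^ d' dvd of_nat n - x \<Longrightarrow> cong_mod_ideal P e (of_int_poly (q_binomial n k)) g"
      using assms(5,6) unfolding q_binomial_tendsto_def by meson
    define n where "n = nat (residue x (d + d'))"
    have "of_nat CARD('p) ^ (d + d') dvd of_nat n - x"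
      using p_power_dvd_diff_residue[of "d + d'" x] unfolding n_def by (simp only: p_power_dvd_diff_iff)
    then have "of_nat CARD('p) ^ d dvd of_nat n - x" "of_nat CARD('p) ^ d' dvd of_nat n - x"
      by (auto simp: power_add dest: dvd_mult_left dvd_mult_right)
    from cong_mod_ideal_trans[OF cong_mod_ideal_sym[OF d[OF this(1)]] d'[OF this(2)]]
    show "of_nat CARD('p) ^ e dvd coeff f i - coeff g i"
      by (rule cong_mod_ideal_degree_less[OF assms(1-4)])
  qed
  then show "coeff f i = coeff g i" by simp
qed

lemma q_binomial_tendsto_exists:
  fixes P :: "'p::prime_card padic_int poly"
  assumes "lead_coeff P = 1" "0 < degree P" and P: "P dvd of_int_poly (q_int (CARD('p) ^ n))"
  obtains f where "degree f < degree P" "q_binomial_tendsto P x k f"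
proof -
  let ?p = "of_nat CARD('p) :: 'p padic_int"
  define N where "N e = nat (residue x (n + e * k))" for e
  have N: "?p ^ (n + e * k) dvd x - of_nat (N e)" for e
    unfolding N_def by (rule p_power_dvd_diff_residue)
  have mod_eq: "m mod CARD('p) ^ d = m' mod CARD('p) ^ d" if "?p ^ d dvd of_nat m - x" "?p ^ d dvd x - of_nat m'" for m m' d
  proof -
    have "?p ^ d dvd (of_nat m - x) + (x - of_nat m')" using that by (rule dvd_add)
    then have "?p ^ d dvd of_nat m - of_nat m'" by simp
    then have "int (m mod CARD('p) ^ d) = int (m' mod CARD('p) ^ d)"
      by (simp add: p_power_dvd_diff_iff residue_of_nat zmod_int)
    then show ?thesis by simp
  qed
  have "\<exists>r. degree r < degree P \<and> cong_mod_ideal P e (of_int_poly (q_binomial (N e) k)) r" for e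
  proof -
    obtain h r where hr: "of_int_poly (q_binomial (N e) k) = P * h + r" "degree r < degree P"
      using monic_remainder[OF assms(1,2)] by blast
    have "cong_mod_ideal P e (of_int_poly (q_binomial (N e) k)) r"
      unfolding hr(1) by (rule cong_mod_ideal_dvd) simp
    with hr(2) show ?thesis by blast
  qed
  then obtain R where R: "\<And>e. degree (R e) < degree P" "\<And>e. cong_mod_ideal P e (of_int_poly (q_binomial (N e) k)) (R e)"
    by metis
  have "?p ^ e dvd coeff (R (Suc e)) i - coeff (R e) i" for e i
  proof -
    have "?p ^ (n + e * k) dvd x - of_nat (N (Suc e))"
      using N[of "Suc e"] by (rule dvd_trans[rotated]) (simp add: le_imp_power_dvd)
    then have "?p ^ (n + e * k) dvd of_nat (N (Suc e)) - x" by (simp only: p_power_dvd_diff_iff)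
    then have "cong_mod_ideal P e (of_int_poly (q_binomial (N (Suc e)) k)) (of_int_poly (q_binomial (N e) k))"
      by (intro q_binomial_cong[OF P] mod_eq) (auto intro: N)
    moreover have "cong_mod_ideal P e (of_int_poly (q_binomial (N (Suc e)) k)) (R (Suc e))"
      using R(2)[of "Suc e"] by (rule cong_mod_ideal_le) simp
    ultimately have "cong_mod_ideal P e (R (Suc e)) (R e)"
      using R(2)[of e] by (metis cong_mod_ideal_sym cong_mod_ideal_trans)
    then show ?thesis by (rule cong_mod_ideal_degree_less[OF assms(1,2) R(1) R(1)])
  qed
  then have "\<exists>l. \<forall>e. ?p ^ e dvd l - coeff (R e) i" for i
    using padic_complete[of "\<lambda>e. coeff (R e) i"] by blast
  then obtain l where l: "\<And>i e. ?p ^ e dvd l i - coeff (R e) i" by metis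
  define f where "f = (\<Sum>i<degree P. monom (l i) i)"
  have coeff_f: "coeff f i = (if i < degree P then l i else 0)" for i
    unfolding f_def coeff_sum by (simp add: sum.delta)
  have deg_f: "degree f < degree P"
    unfolding f_def using assms(2) by (intro degree_sum_less) (auto intro: le_less_trans[OF degree_monom_le])
  have f_R: "cong_mod_ideal P e (R e) f" for e
  proof -
    have "[:?p ^ e:] dvd f - R e"
    proof (rule const_poly_dvd_iff[THEN iffD2], intro allI)
      fix i
      show "?p ^ e dvd coeff (f - R e) i"
      proof (cases "i < degree P")
        case True
        then show ?thesis using l[of e i] by (simp add: coeff_f)
      next
        case False
        then have "degree (R e) < i" using R(1)[of e] by simp
        then show ?thesis using False by (simp add: coeff_f coeff_eq_0)
      qed
    qed
    then obtain w where w: "f - R e = [:?p ^ e:] * w" ..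
    have "[:?p ^ e:] = of_nat CARD('p) ^ e"
      using of_nat_poly[of "CARD('p) ^ e", where ?'a = "'p padic_int"] by simp
    with w have "f - R e = P * 0 + of_nat CARD('p) ^ e * w" by simp
    then have "cong_mod_ideal P e f (R e)" unfolding cong_mod_ideal_def by blast
    then show ?thesis by (rule cong_mod_ideal_sym)
  qed
  have "q_binomial_tendsto P x k f"
    unfolding q_binomial_tendsto_def
  proof (intro allI exI impI)
    fix e m
    assume "?p ^ (n + e * k) dvd of_nat m - x"
    then have "cong_mod_ideal P e (of_int_poly (q_binomial m k)) (of_int_poly (q_binomial (N e) k))"
      by (intro q_binomial_cong[OF P] mod_eq) (auto intro: N)
    then show "cong_mod_ideal P e (of_int_poly (q_binomial m k)) f"
      using R(2)[of e] f_R[of e] by (metis cong_mod_ideal_trans)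
  qed
  with deg_f show ?thesis using that by blast
qed

lemma padic_q_binomial_characterization:
  fixes P :: "'p::prime_card padic_int poly"
  assumes "lead_coeff P = 1" "0 < degree P" "P dvd of_int_poly (q_int (CARD('p) ^ n))"
  shows "degree (padic_q_binomial P x k) < degree P" "q_binomial_tendsto P x k (padic_q_binomial P x k)"
proof -
  have "\<exists>!f. degree f < degree P \<and> q_binomial_tendsto P x k f"
    using q_binomial_tendsto_exists[OF assms] q_binomial_tendsto_unique[OF assms(1,2)] by metis
  from theI'[OF this] show "degree (padic_q_binomial P x k) < degree P"
    "q_binomial_tendsto P x k (padic_q_binomial P x k)"
    unfolding padic_q_binomial_def by auto
qed

lemma padic_q_binomial_of_nat:
  fixes P :: "'p::prime_card padic_int poly"
  assumes "lead_coeff P = 1" "0 < degree P" "P dvd of_int_poly (q_int (CARD('p) ^ n))"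
  shows "P dvd of_int_poly (q_binomial m k) - padic_q_binomial P (of_nat m) k"
proof -
  obtain h r where hr: "of_int_poly (q_binomial m k) = P * h + r" "degree r < degree P"
    using monic_remainder[OF assms(1,2)] by blast
  have "q_binomial_tendsto P (of_nat m) k r"
    unfolding q_binomial_tendsto_def
  proof (intro allI exI impI)
    fix e N
    assume "of_nat CARD('p) ^ (n + e * k) dvd of_nat N - (of_nat m :: 'p padic_int)"
    then have "int (N mod CARD('p) ^ (n + e * k)) = int (m mod CARD('p) ^ (n + e * k))"
      by (simp add: p_power_dvd_diff_iff residue_of_nat zmod_int)
    then have "cong_mod_ideal P e (of_int_poly (q_binomial N k)) (of_int_poly (q_binomial m k))"
      by (intro q_binomial_cong[OF assms(3)]) simp
    also have "cong_mod_ideal P e \<dots> r" unfolding hr(1) by (rule cong_mod_ideal_dvd) simp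
    finally show "cong_mod_ideal P e (of_int_poly (q_binomial N k)) r" .
  qed
  then have "padic_q_binomial P (of_nat m) k = r"
    using q_binomial_tendsto_unique[OF assms(1,2)] padic_q_binomial_characterization[OF assms] hr(2) by metis
  then show ?thesis by (simp add: hr(1))
qed

lemma padic_q_binomial_continuous:
  fixes P :: "'p::prime_card padic_int poly"
  assumes P: "lead_coeff P = 1" "0 < degree P" "P dvd of_int_poly (q_int (CARD('p) ^ n))"
  shows "\<exists>d. \<forall>y. of_nat CARD('p) ^ d dvd y - x \<longrightarrow>
    cong_mod_ideal P e (padic_q_binomial P y k) (padic_q_binomial P x k)"
proof -
  obtain d where d: "\<And>N. of_nat CARD('p) ^ d dvd of_nat N - x \<Longrightarrow>
      cong_mod_ideal P e (of_int_poly (q_binomial N k)) (padic_q_binomial P x k)"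
    using padic_q_binomial_characterization(2)[OF P] unfolding q_binomial_tendsto_def by meson
  have "cong_mod_ideal P e (padic_q_binomial P y k) (padic_q_binomial P x k)"
    if y: "of_nat CARD('p) ^ d dvd y - x" for y
  proof -
    obtain d' where d': "\<And>N. of_nat CARD('p) ^ d' dvd of_nat N - y \<Longrightarrow>
        cong_mod_ideal P e (of_int_poly (q_binomial N k)) (padic_q_binomial P y k)"
      using padic_q_binomial_characterization(2)[OF P] unfolding q_binomial_tendsto_def by meson
    define N where "N = nat (residue y (d + d'))"
    have "of_nat CARD('p) ^ (d + d') dvd of_nat N - y"
      using p_power_dvd_diff_residue[of "d + d'" y] unfolding N_def by (simp only: p_power_dvd_diff_iff)
    then have N: "of_nat CARD('p) ^ d dvd of_nat N - y" "of_nat CARD('p) ^ d' dvd of_nat N - y"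
      by (auto simp: power_add dest: dvd_mult_left dvd_mult_right)
    have "of_nat CARD('p) ^ d dvd of_nat N - x"
      using N(1) y by (simp only: p_power_dvd_diff_iff)
    from cong_mod_ideal_trans[OF cong_mod_ideal_sym[OF d'[OF N(2)]] d[OF this]] show ?thesis .
  qed
  then show ?thesis by blast
qed

lemma padic_q_binomial_dvd_modulus:
  fixes P P' :: "'p::prime_card padic_int poly"
  assumes P: "lead_coeff P = 1" "0 < degree P" "P dvd of_int_poly (q_int (CARD('p) ^ n))"
    and P': "lead_coeff P' = 1" "0 < degree P'" "P' dvd P"
  shows "P' dvd padic_q_binomial P x k - padic_q_binomial P' x k"
proof -
  have P'_dvd: "P' dvd of_int_poly (q_int (CARD('p) ^ n))" using P'(3) P(3) by (rule dvd_trans)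
  have le: "cong_mod_ideal P' e f g" if "cong_mod_ideal P e f g" for e f g
  proof -
    obtain u v where "f - g = P * u + of_nat CARD('p) ^ e * v"
      using \<open>cong_mod_ideal P e f g\<close> unfolding cong_mod_ideal_def by blast
    moreover obtain w where "P = P' * w" using P'(3) ..
    ultimately have "f - g = P' * (w * u) + of_nat CARD('p) ^ e * v" by (simp only: mult.assoc)
    then show ?thesis unfolding cong_mod_ideal_def by blast
  qed
  obtain h r where hr: "padic_q_binomial P x k = P' * h + r" "degree r < degree P'"
    using monic_remainder[OF P'(1,2)] by blast
  have "cong_mod_ideal P' e (padic_q_binomial P x k) r" for e
    unfolding hr(1) by (rule cong_mod_ideal_dvd) simp
  then have "cong_mod_ideal P' e (of_int_poly (q_binomial N k)) r"
    if "cong_mod_ideal P e (of_int_poly (q_binomial N k)) (padic_q_binomial P x k)" for e N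
    using le[OF that] by (rule cong_mod_ideal_trans[rotated])
  then have "q_binomial_tendsto P' x k r"
    using padic_q_binomial_characterization(2)[OF P, of x k]
    unfolding q_binomial_tendsto_def by blast
  then have "padic_q_binomial P' x k = r"
    by (rule q_binomial_tendsto_unique[OF P'(1,2)
      padic_q_binomial_characterization(1)[OF P'(1,2) P'_dvd] hr(2)
      padic_q_binomial_characterization(2)[OF P'(1,2) P'_dvd]])
  then show ?thesis by (simp add: hr(1))
qed

text \<open>The moduli occurring in the statement are admissible.\<close>

lemma monic_of_int_poly:
  assumes "lead_coeff f = 1" "0 < degree f"
  shows "lead_coeff (of_int_poly f :: 'p::prime_card padic_int poly) = 1"
    "0 < degree (of_int_poly f :: 'p padic_int poly)"
  using assms by simp_all

lemma q_int_admissible: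
  assumes "1 \<le> n"
  shows "lead_coeff (of_int_poly (q_int (CARD('p) ^ n)) :: 'p::prime_card padic_int poly) = 1"
    "0 < degree (of_int_poly (q_int (CARD('p) ^ n)) :: 'p padic_int poly)"
proof -
  have "1 < CARD('p) ^ n" using assms CARD_prime_card_gt_1[where ?'p = 'p] by (intro one_less_power) auto
  note monic_q_int[OF this]
  from monic_of_int_poly[OF this] show
    "lead_coeff (of_int_poly (q_int (CARD('p) ^ n)) :: 'p::prime_card padic_int poly) = 1"
    "0 < degree (of_int_poly (q_int (CARD('p) ^ n)) :: 'p padic_int poly)" by auto
qed

lemma cyclotomic_admissible:
  assumes "1 \<le> m" "m \<le> n"
  shows "lead_coeff (of_int_poly (cyclotomic (CARD('p) ^ m)) :: 'p::prime_card padic_int poly) = 1"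
    "0 < degree (of_int_poly (cyclotomic (CARD('p) ^ m)) :: 'p padic_int poly)"
    "of_int_poly (cyclotomic (CARD('p) ^ m)) dvd (of_int_poly (q_int (CARD('p) ^ n)) :: 'p padic_int poly)"
  using monic_of_int_poly[OF monic_cyclotomic[OF prime_card assms(1)]]
    of_int_poly_hom.hom_dvd[OF cyclotomic_dvd_q_int[OF prime_card assms]]
  by auto

end

theory Submission
  imports Defs
begin

text \<open>
  With \<open>A = a / 2\<close> and \<open>B = b / 2\<close>, the lower indices \<open>k\<close> have base-\<open>p\<close> digits \<open>A\<close> and \<open>B\<close>, while
  all digits of \<open>\<alpha>\<close> are \<open>A + B < p\<close>.  By continuity \<open>\<alpha> - i\<close> may be replaced by a natural number
  \<open>N\<close> with \<open>N + i \<equiv> \<alpha>\<close> modulo \<open>p ^ n\<close>.  At a primitive \<open>p ^ m\<close>-th root of unity the \<open>q\<close>-Lucas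
  theorem splits off the residues modulo \<open>p ^ m\<close>, and the resulting product is symmetric under
  \<open>k \<mapsto> \<alpha> - k\<close>, that is, under complementing the lowest \<open>m\<close> bits of \<open>r\<close>, which changes the sign.
  Hence the sum vanishes at all roots of \<open>[p ^ n]\<close>; part (c) is the case \<open>q = 1\<close>.
\<close>

section \<open>Gaussian binomial coefficients at roots of unity\<close>

lemma poly_q_int_mult: "poly (of_int_poly (q_int n)) z * (1 - z) = 1 - (z :: 'a::idom) ^ n"
  using arg_cong[OF q_int_mult[of n], of "\<lambda>f. poly (of_int_poly f) z"]
  by (simp add: hom_distribs poly_monom)

lemma poly_q_fact_eq_0_iff:
  "poly (of_int_poly (q_fact n)) (z :: 'a::idom) = 0 \<longleftrightarrow> (\<exists>j\<in>{1..n}. poly (of_int_poly (q_int j)) z = 0)"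
  unfolding q_fact_def by (simp add: of_int_poly_hom.hom_prod poly_prod)

text \<open>In \<open>[l]! = [l choose k] [k]! [l - k]!\<close> the left side contains
  \<open>[l]\<close>, which vanishes at \<open>z\<close>, while \<open>[j]\<close> is nonzero at
  \<open>z\<close> for 0 < j < l.\<close>

lemma poly_q_binomial_eq_0:
  fixes z :: "'a::idom"
  assumes "z ^ l = 1" "\<And>j. 0 < j \<Longrightarrow> j < l \<Longrightarrow> z ^ j \<noteq> 1" "0 < k" "k < l"
  shows "poly (of_int_poly (q_binomial l k)) z = 0"
proof -
  have z: "z \<noteq> 1" using assms(2)[of 1] assms(3,4) by simp
  have nz: "poly (of_int_poly (q_fact j)) z \<noteq> 0" if "j < l" for j
  proof -
    have "poly (of_int_poly (q_int i)) z \<noteq> 0" if "i \<in> {1..j}" for i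
      using poly_q_int_mult[of i z] assms(2)[of i] that \<open>j < l\<close> by auto
    then show ?thesis by (simp add: poly_q_fact_eq_0_iff)
  qed
  have "poly (of_int_poly (q_int l)) z = 0"
    using poly_q_int_mult[of l z] assms(1) z by simp
  then have "poly (of_int_poly (q_fact l)) z = 0"
    using assms(3,4) by (auto simp: poly_q_fact_eq_0_iff intro!: bexI[of _ l])
  moreover have "q_fact l = q_binomial l k * (q_fact k * q_fact (l - k))"
    using q_binomial_fact[of k l] assms(4) by simp
  ultimately show ?thesis
    using nz[of k] nz[of "l - k"] assms(3,4) by (simp add: hom_distribs)
qed

lemma poly_q_binomial_Suc:
  "poly (of_int_poly (q_binomial (Suc n) (Suc k))) z =
    poly (of_int_poly (q_binomial n k)) z +
    z ^ Suc k * poly (of_int_poly (q_binomial n (Suc k))) (z :: 'a::comm_ring_1)"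
  by (simp add: q_binomial_Suc hom_distribs poly_monom)

lemma q_binomial_eq_0: "n < k \<Longrightarrow> q_binomial n k = 0"
  by (simp add: q_binomial_def)

lemma q_binomial_self: "q_binomial n n = 1"
  using q_binomial_fact[of n n] by (simp add: q_fact_nonzero q_fact_def[of 0])

text \<open>Induction on \<open>n\<close> by the \<open>q\<close>-Pascal rule; the hypotheses say
  that \<open>z\<close> has exact order \<open>l\<close>.\<close>

lemma q_Lucas:
  fixes z :: "'a::idom"
  assumes z: "z ^ l = 1" "\<And>j. 0 < j \<Longrightarrow> j < l \<Longrightarrow> z ^ j \<noteq> 1" and l: "0 < l"
  shows "poly (of_int_poly (q_binomial n k)) z =
    of_nat (n div l choose (k div l)) * poly (of_int_poly (q_binomial (n mod l) (k mod l))) z"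
proof (induction n arbitrary: k)
  case 0
  show ?case
  proof (cases "k < l")
    case False
    then have "0 div l choose (k div l) = 0" using l by (simp add: div_greater_zero_iff binomial_eq_0)
    then have "of_nat (0 div l choose (k div l)) = (0::'a)" by (simp only: of_nat_0)
    then show ?thesis using False l by (simp add: q_binomial_eq_0 del: div_0)
  qed simp
next
  case (Suc n)
  define G where "G n k = poly (of_int_poly (q_binomial n k)) z" for n k
  have G_Suc: "G (Suc n) (Suc k) = G n k + z ^ Suc k * G n (Suc k)" for n k
    unfolding G_def by (rule poly_q_binomial_Suc)
  have G_0: "G n 0 = 1" and G_self: "G n n = 1" and G_less: "n < k \<Longrightarrow> G n k = 0" for n k
    by (simp_all add: G_def q_binomial_0_right q_binomial_self q_binomial_eq_0)
  have G_l: "G l k = 0" if "0 < k" "k < l" for k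
    unfolding G_def using z that by (rule poly_q_binomial_eq_0)
  have IH: "G n k = of_nat (n div l choose (k div l)) * G (n mod l) (k mod l)" for k
    using Suc.IH by (simp add: G_def)
  have "G (Suc n) k = of_nat (Suc n div l choose (k div l)) * G (Suc n mod l) (k mod l)"
  proof (cases k)
    case 0
    then show ?thesis by (simp add: G_0)
  next
    case [simp]: (Suc j)
    have zpow: "z ^ i = z ^ (i mod l)" for i
    proof -
      have "z ^ i = (z ^ l) ^ (i div l) * z ^ (i mod l)" by (simp flip: power_add power_mult)
      then show ?thesis by (simp add: z(1))
    qed
    have eq: "G (Suc n) (Suc j) = of_nat (n div l choose (j div l)) * G (n mod l) (j mod l)
        + z ^ (Suc j mod l) * (of_nat (n div l choose (Suc j div l)) * G (n mod l) (Suc j mod l))"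
      using G_Suc[of n j] IH[of j] IH[of "Suc j"] zpow[of "Suc j"] by simp
    \<comment> \<open>The cases ask whether \<open>n\<close> and \<open>j\<close> are -1 modulo
      \<open>l\<close>, so that the successor carries into the quotient by \<open>l\<close>.\<close>
    show ?thesis
    proof (cases "Suc (n mod l) = l"; cases "Suc (j mod l) = l")
      assume *: "Suc (n mod l) = l" "Suc (j mod l) = l"
      then have "n mod l = j mod l" by simp
      with * show ?thesis unfolding Suc eq by (simp add: mod_Suc div_Suc G_0 G_self)
    next
      assume *: "Suc (n mod l) = l" "Suc (j mod l) \<noteq> l"
      then have "Suc (j mod l) < l" using l by (simp add: Suc_lessI)
      \<comment> \<open>Pascal's rule turns this combination into a coefficient with upper index
        \<open>l\<close> and lower index strictly between 0 and \<open>l\<close>, which is zero at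
        \<open>z\<close>.\<close>
      then have "G (n mod l) (j mod l) + z ^ Suc (j mod l) * G (n mod l) (Suc (j mod l)) = 0"
        using G_Suc[of "n mod l" "j mod l"] G_l * by simp
      then have "of_nat (n div l choose (j div l)) *
          (G (n mod l) (j mod l) + z ^ Suc (j mod l) * G (n mod l) (Suc (j mod l))) = 0" by simp
      with * show ?thesis unfolding Suc eq by (simp add: mod_Suc div_Suc G_less algebra_simps)
    next
      assume *: "Suc (n mod l) \<noteq> l" "Suc (j mod l) = l"
      then have "n mod l < j mod l" using l by (metis Suc_lessI mod_less_divisor not_less_eq)
      with * show ?thesis unfolding Suc eq by (simp add: mod_Suc div_Suc G_0 G_less)
    next
      assume *: "Suc (n mod l) \<noteq> l" "Suc (j mod l) \<noteq> l"
      then show ?thesis unfolding Suc eq by (simp add: mod_Suc div_Suc G_Suc algebra_simps)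
    qed
  qed
  then show ?case by (simp add: G_def)
qed

text \<open>Where it does not vanish, the product is \<open>[t - i]! / ([i]! [k - i]! [t - i - k]!)\<close>.\<close>

lemma q_binomial_product_symmetric:
  assumes "k \<le> t"
  shows "q_binomial k i * q_binomial (t - i) k = q_binomial (t - k) i * q_binomial (t - i) (t - k)"
proof -
  consider "i \<le> k" "k \<le> t - i" "i \<le> t" | "k < i" | "t - i < k"
    using assms by linarith
  then show ?thesis
  proof cases
    case 1
    have *: "q_binomial k i * q_binomial (t - i) k * (q_fact i * q_fact (k - i) * q_fact (t - i - k)) = q_fact (t - i)"
      if "i \<le> k" "k \<le> t - i" "i \<le> t" for k
    proof -
      have "q_fact k * (q_binomial k i * q_binomial (t - i) k * (q_fact i * q_fact (k - i) * q_fact (t - i - k))) =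
          (q_binomial k i * (q_fact i * q_fact (k - i))) * (q_binomial (t - i) k * (q_fact k * q_fact (t - i - k)))"
        by (simp only: mult_ac)
      also have "\<dots> = q_fact k * q_fact (t - i)" using that by (simp only: q_binomial_fact)
      finally show ?thesis by (simp add: q_fact_nonzero)
    qed
    \<comment> \<open>Passing from \<open>k\<close> to \<open>t - k\<close> exchanges the factors
      \<open>[k - i]!\<close> and \<open>[t - i - k]!\<close> of the denominator.\<close>
    have "t - k - i = t - i - k" "t - i - (t - k) = k - i" using 1 by auto
    then have "q_binomial (t - k) i * q_binomial (t - i) (t - k) *
        (q_fact i * q_fact (k - i) * q_fact (t - i - k)) = q_fact (t - i)"
      using *[of "t - k"] 1 by (simp add: mult_ac)
    with *[OF 1] have "q_binomial k i * q_binomial (t - i) k * (q_fact i * q_fact (k - i) * q_fact (t - i - k)) =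
      q_binomial (t - k) i * q_binomial (t - i) (t - k) * (q_fact i * q_fact (k - i) * q_fact (t - i - k))" by simp
    then show ?thesis by (simp add: q_fact_nonzero)
  next
    case 2
    \<comment> \<open>Subtraction is truncated: the second factor vanishes if
      \<open>i \<le> t\<close>, the first one otherwise.\<close>
    have "q_binomial (t - k) i * q_binomial (t - i) (t - k) = 0"
      using 2 assms by (cases "i \<le> t") (auto simp: q_binomial_eq_0)
    with 2 show ?thesis by (simp add: q_binomial_eq_0)
  next
    case 3
    have "q_binomial (t - k) i = 0" using 3 assms by (cases "i \<le> t") (auto simp: q_binomial_eq_0)
    with 3 show ?thesis by (simp add: q_binomial_eq_0)
  qed
qed

section \<open>Base-\<open>p\<close> digits and complementation of bits\<close>

text \<open>All digits are even, so halving works digit by digit and the lower indices are again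
  digit numbers.\<close>

lemma digit_number_half:
  assumes "even a" "even b"
  shows "digit_number p a b s r div 2 = digit_number p (a div 2) (b div 2) s r"
proof -
  obtain a' b' where [simp]: "a = 2 * a'" "b = 2 * b'" using assms by (auto elim!: evenE)
  have "digit_number p a b s r = 2 * digit_number p a' b' s r"
    unfolding digit_number_def sum_distrib_left
    by (rule sum.cong) (simp_all add: algebra_simps diff_mult_distrib2)
  then show ?thesis by simp
qed

lemma digit_number_Suc:
  "digit_number p a b (Suc s) r = (b - a) * of_bool (odd r) + a + p * digit_number p a b s (r div 2)"
  unfolding digit_number_def
  by (simp add: sum.lessThan_Suc_shift bit_Suc bit_0 sum_distrib_left algebra_simps del: sum.lessThan_Suc)

lemma digit_number_split:
  "digit_number p a b (m + s) r = digit_number p a b m (r mod 2 ^ m) + p ^ m * digit_number p a b s (r div 2 ^ m)"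
proof (induction m arbitrary: r)
  case (Suc m)
  have "r mod 2 ^ Suc m div 2 = r div 2 mod 2 ^ m" by (simp add: mod_mult2_eq)
  moreover have "odd (r mod 2 ^ Suc m) = odd r" by (simp add: mod_mult2_eq)
  moreover have "r div 2 ^ Suc m = r div 2 div 2 ^ m" by (simp add: div_mult2_eq)
  ultimately show ?case using Suc[of "r div 2"] by (simp add: digit_number_Suc algebra_simps)
qed (simp add: digit_number_def)

text \<open>The low bits of \<open>2 ^ m - 1 - r\<close> are complementary to those of
  \<open>r\<close>, so the digits \<open>a\<close> and \<open>b\<close> trade places and each
  position contributes \<open>a + b\<close>.\<close>

lemma digit_number_complement:
  assumes "a \<le> b" "r < 2 ^ m"
  shows "digit_number p a b m r + digit_number p a b m (2 ^ m - 1 - r) = (\<Sum>j<m. (a + b) * p ^ j)"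
  using assms(2)
proof (induction m arbitrary: r)
  case (Suc m)
  have "odd (2 ^ Suc m - 1 - r) \<longleftrightarrow> even r" using Suc.prems by (simp add: even_diff_nat) 
  moreover have "(2 ^ Suc m - 1 - r) div 2 = 2 ^ m - 1 - r div 2" using Suc.prems by auto
  moreover have "r div 2 < 2 ^ m" using Suc.prems by auto
  ultimately have "digit_number p a b (Suc m) r + digit_number p a b (Suc m) (2 ^ Suc m - 1 - r) =
      a + b + p * (digit_number p a b m (r div 2) + digit_number p a b m (2 ^ m - 1 - r div 2))"
    using assms(1) by (simp add: digit_number_Suc algebra_simps)
  also have "\<dots> = a + b + p * (\<Sum>j<m. (a + b) * p ^ j)"
    using Suc.IH[OF \<open>r div 2 < 2 ^ m\<close>] by simp
  also have "\<dots> = (\<Sum>j<Suc m. (a + b) * p ^ j)"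
    by (simp add: sum.lessThan_Suc_shift sum_distrib_left mult_ac del: sum.lessThan_Suc)
  finally show ?case .
qed (simp add: digit_number_def)

lemma sum_digits_less:
  assumes "c < (p::nat)"
  shows "(\<Sum>j<m. c * p ^ j) < p ^ m"
proof (induction m)
  case (Suc m)
  have "(\<Sum>j<Suc m. c * p ^ j) < (c + 1) * p ^ m" using Suc by simp
  also have "\<dots> \<le> p * p ^ m" using assms by (intro mult_right_mono) auto
  finally show ?case by simp
qed simp

lemma sum_digits_mod:
  assumes "c < (p::nat)" "m \<le> n"
  shows "(\<Sum>j<n. c * p ^ j) mod p ^ m = (\<Sum>j<m. c * p ^ j)"
  \<comment> \<open>With both digits equal to \<open>c\<close>, \<open>digit_number\<close> is the
    repeated-digit sum, whatever the bits.\<close>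
  using digit_number_split[of p c c m "n - m" 0] sum_digits_less[OF assms(1), of m] assms(2)
  by (simp add: digit_number_def)

section \<open>Vanishing of the alternating sum at primitive roots of unity\<close>

text \<open>Modulo \<open>l = p ^ m\<close> the summand depends, up to factors unaffected by the lowest \<open>m\<close> bits of \<open>r\<close>,
  only on the residues; complementing these bits turns the residue of \<open>k\<close> into \<open>t - k\<close> and changes the sign.\<close>

lemma signed_sum_eq_0:
  fixes z :: "'a::{idom,ring_char_0}"
  assumes z: "z ^ (p ^ m) = 1" "\<And>j. 0 < j \<Longrightarrow> j < p ^ m \<Longrightarrow> z ^ j \<noteq> 1"
    and m: "0 < m" "m \<le> n" "m \<le> s" and ab: "a \<le> b" "a + b < p"
    and N: "(N + i) mod p ^ m = (\<Sum>j<m. (a + b) * p ^ j)"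
  shows "(\<Sum>r<2 ^ n. (- 1) ^ r * poly (of_int_poly (q_binomial (digit_number p a b s r) i)) z *
    poly (of_int_poly (q_binomial N (digit_number p a b s r))) z) = 0"
proof -
  define t where "t = (\<Sum>j<m. (a + b) * p ^ j)"
  define l where "l = p ^ m"
  have l: "0 < l" using ab by (simp add: l_def)
  have t: "t < l" unfolding t_def l_def using ab(2) by (rule sum_digits_less)
  define G where "G n k = poly (of_int_poly (q_binomial n k)) z" for n k
  have Lucas: "G n k = of_nat (n div l choose (k div l)) * G (n mod l) (k mod l)" for n k
    unfolding G_def using z l unfolding l_def by (rule q_Lucas)
  define K where "K r = digit_number p a b s r" for r
  define K0 where "K0 r = digit_number p a b m r" for r
  have K0: "K0 r + K0 (2 ^ m - 1 - r) = t" if "r < 2 ^ m" for r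
    unfolding K0_def t_def by (rule digit_number_complement) fact+
  have K: "K r = K0 (r mod 2 ^ m) + l * digit_number p a b (s - m) (r div 2 ^ m)" for r
    unfolding K_def K0_def l_def using digit_number_split[of p a b m "s - m" r] m(3) by simp
  have "K0 (r mod 2 ^ m) \<le> t" for r using K0[of "r mod 2 ^ m"] by simp
  then have K0_less: "K0 (r mod 2 ^ m) < l" for r using t by (meson le_less_trans)
  have K_mod: "K r mod l = K0 (r mod 2 ^ m)"
    and K_div: "K r div l = digit_number p a b (s - m) (r div 2 ^ m)" for r
    using K0_less[of r] by (simp_all add: K)
  \<comment> \<open>\<open>f\<close> complements the lowest \<open>m\<close> bits and keeps the
    others; as \<open>m \<le> n\<close>, it is an involution of the index range.\<close>
  define f where "f r = (2 ^ m - 1 - r mod 2 ^ m) + 2 ^ m * (r div 2 ^ m)" for r :: nat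
  have less: "2 ^ m - 1 - r mod 2 ^ m < (2::nat) ^ m" for r :: nat
    by (rule le_less_trans[of _ "2 ^ m - 1"]) simp_all
  have f_mod: "f r mod 2 ^ m = 2 ^ m - 1 - r mod 2 ^ m" and f_div: "f r div 2 ^ m = r div 2 ^ m" for r
    using less[of r] unfolding f_def by (simp_all del: diff_diff_left)
  have f_f: "f (f r) = r" for r
  proof -
    have "r mod 2 ^ m < 2 ^ m" by simp
    then have "f (f r) = r mod 2 ^ m + 2 ^ m * (r div 2 ^ m)"
      unfolding f_def[of "f r"] f_mod f_div by linarith
    then show ?thesis by simp
  qed
  have f_less: "f r < 2 ^ n" if "r < 2 ^ n" for r
  proof -
    have n: "(2::nat) ^ n = 2 ^ (n - m) * 2 ^ m" using m(2) by (simp flip: power_add)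
    have "f r div 2 ^ m < 2 ^ (n - m)" unfolding f_div
      using that unfolding n by (simp add: less_mult_imp_div_less)
    then show ?thesis unfolding n by (simp add: div_less_iff_less_mult)
  qed
  \<comment> \<open>The sum of \<open>f r\<close> and \<open>r\<close> is odd, because
    \<open>2 ^ m - 1\<close> is odd for m > 0.\<close>
  have sign: "(- 1) ^ f r = - ((- 1) ^ r :: 'a)" for r
  proof -
    have "r mod 2 ^ m < 2 ^ m" by simp
    then have "f r + r = 2 ^ m - 1 + 2 * (2 ^ m * (r div 2 ^ m))"
      using mod_mult_div_eq[of r "2 ^ m"] unfolding f_def by linarith
    moreover have "odd (2 ^ m - 1 :: nat)" using m(1) by simp
    ultimately have "odd (f r + r)" by simp
    then show ?thesis by (cases "even r") auto
  qed
  define h where "h r = G (K r) i * G N (K r)" for r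
  have h_f: "h (f r) = h r" for r
  proof -
    let ?k = "K0 (r mod 2 ^ m)" and ?i = "i mod l" and ?N = "N mod l"
    have k: "K0 (f r mod 2 ^ m) = t - ?k" "?k \<le> t" using K0[of "r mod 2 ^ m"] by (simp_all add: f_mod)
    have "G ?k ?i * G ?N ?k = G (t - ?k) ?i * G ?N (t - ?k)"
    proof (cases "?i \<le> t")
      case True
      have "(?N + ?i) mod l = t" using N by (simp add: mod_add_eq l_def t_def)
      \<comment> \<open>A carry in the sum would give \<open>?N = t + l - ?i\<close>, which is at
        least \<open>l\<close>.\<close>
      have "?N = t - ?i"
      proof (cases "?N + ?i < l")
        case True
        then show ?thesis using \<open>(?N + ?i) mod l = t\<close> by simp
      next
        case False
        have *: "?N < l" "?i < l" using l by simp_all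
        then have "(?N + ?i) mod l = ?N + ?i - l" using False le_mod_geq[of l "?N + ?i"] mod_less[of "?N + ?i - l" l] by linarith
        then show ?thesis using \<open>(?N + ?i) mod l = t\<close> * \<open>?i \<le> t\<close> False by linarith
      qed
      then show ?thesis
        using q_binomial_product_symmetric[OF k(2), of ?i] unfolding G_def
        by (metis of_int_poly_hom.hom_mult poly_mult)
    next
      case False
      then have "q_binomial ?k ?i = 0" "q_binomial (t - ?k) ?i = 0"
        using k(2) by (simp_all add: q_binomial_eq_0)
      then show ?thesis by (simp add: G_def)
    qed
    \<comment> \<open>By \<open>Lucas\<close> the comparison of residues is enough: \<open>f\<close>
      leaves the quotient of \<open>K r\<close> by \<open>l\<close> unchanged.\<close>
    then show ?thesis
      unfolding h_def Lucas[of "K _"] Lucas[of N "K _"] K_mod K_div f_div k by (simp add: algebra_simps)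
  qed
  define S where "S = (\<Sum>r<2 ^ n. (- 1) ^ r * h r)"
  \<comment> \<open>Reindexing by the involution reverses every sign; S = -S then forces S = 0 in
    characteristic 0.\<close>
  have "S = (\<Sum>r<2 ^ n. (- 1) ^ f r * h (f r))"
    unfolding S_def by (rule sum.reindex_bij_witness[of _ f f]) (auto simp: f_f f_less)
  also have "\<dots> = - S" by (simp add: S_def sign h_f sum_negf)
  finally have "2 * S = 0" by simp
  then have "S = 0" by simp
  then show ?thesis by (simp add: S_def h_def G_def K_def mult.assoc)
qed

section \<open>From roots of unity to divisibility by \<open>[p ^ n]\<close>\<close>

text \<open>The order of \<open>z\<close> divides \<open>p ^ n\<close>, hence is a power
  \<open>p ^ m\<close>, and \<open>z \<noteq> 1\<close> excludes m = 0.\<close>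

lemma root_of_unity_primitive_prime_power:
  fixes z :: "'a::monoid_mult"
  assumes "prime p" "z ^ (p ^ n) = 1" "z \<noteq> 1"
  obtains m where "0 < m" "m \<le> n" "z ^ (p ^ m) = 1" "\<And>j. 0 < j \<Longrightarrow> j < p ^ m \<Longrightarrow> z ^ j \<noteq> 1"
proof -
  define e where "e = (LEAST e. 0 < e \<and> z ^ e = 1)"
  have "0 < p ^ n" using prime_gt_0_nat[OF assms(1)] by simp
  then have e: "0 < e" "z ^ e = 1"
    using LeastI[of "\<lambda>e. 0 < e \<and> z ^ e = 1" "p ^ n"] assms(2) by (auto simp: e_def)
  have min: "z ^ j \<noteq> 1" if "0 < j" "j < e" for j
    using not_less_Least[of j "\<lambda>e. 0 < e \<and> z ^ e = 1"] that by (auto simp: e_def)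
  have "z ^ (p ^ n) = (z ^ e) ^ (p ^ n div e) * z ^ (p ^ n mod e)"
    by (simp flip: power_add power_mult)
  then have "z ^ (p ^ n mod e) = 1" using assms(2) e(2) by simp
  then have "p ^ n mod e = 0" using min[of "p ^ n mod e"] e(1) by (meson mod_less_divisor neq0_conv)
  then obtain m where m: "m \<le> n" "e = p ^ m"
    using divides_primepow_nat[OF assms(1)] by (auto simp: dvd_eq_mod_eq_0)
  have "0 < m" using m(2) e(2) assms(3) by (cases m) auto
  then show ?thesis using that m e(2) min by blast
qed

text \<open>Division by the monic \<open>[l]\<close> stays integral. The remainder has degree below
  l - 1 but vanishes at the l - 1 nontrivial \<open>l\<close>-th roots of unity, so it is
  zero.\<close>

lemma q_int_dvd_if_roots:
  assumes "1 < l" "\<And>z :: complex. z ^ l = 1 \<Longrightarrow> z \<noteq> 1 \<Longrightarrow> poly (of_int_poly f) z = 0"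
  shows "q_int l dvd f"
proof -
  obtain h r where hr: "f = q_int l * h + r" "degree r < degree (q_int l)"
    using monic_remainder[OF monic_q_int[OF assms(1)]] by blast
  let ?r = "of_int_poly r :: complex poly"
  have "poly ?r z = 0" if z: "z ^ l = 1" "z \<noteq> 1" for z
  proof -
    have "poly (of_int_poly (q_int l)) z = 0" using poly_q_int_mult[of l z] z by simp
    then show ?thesis using assms(2)[OF z] by (simp add: hr(1) hom_distribs)
  qed
  then have sub: "{z. z ^ l = 1} - {1} \<subseteq> {z. poly ?r z = 0}" by auto
  have "?r = 0"
  proof (rule ccontr)
    assume "?r \<noteq> 0"
    have "l - 1 = card ({z :: complex. z ^ l = 1} - {1})"
      using assms(1) by (simp add: card_roots_unity_eq)
    also have "\<dots> \<le> card {z. poly ?r z = 0}"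
      using poly_roots_finite[OF \<open>?r \<noteq> 0\<close>] sub by (rule card_mono)
    also have "\<dots> \<le> degree ?r" using \<open>?r \<noteq> 0\<close> by (rule poly_roots_degree)
    finally have "l - 1 \<le> degree r" by simp
    moreover have "degree (q_int l) \<le> l - 1"
      unfolding q_int_eq_sum by (intro degree_sum_le order.trans[OF degree_monom_le]) auto
    ultimately show False using hr(2) by simp
  qed
  then show ?thesis by (simp add: hr(1))
qed

text \<open>The congruence over the integers, with a natural upper argument: each nontrivial root
  has some order \<open>p ^ m\<close> with \<open>1 \<le> m \<le> n\<close>, to which
  \<open>signed_sum_eq_0\<close> applies.\<close>

lemma q_int_dvd_signed_sum:
  assumes "prime p" "1 \<le> n" "n \<le> s" "a \<le> b" "a + b < p"
    and N: "(N + i) mod p ^ n = (\<Sum>j<n. (a + b) * p ^ j)"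
  shows "q_int (p ^ n) dvd
    (\<Sum>r<2 ^ n. (- 1) ^ r * q_binomial (digit_number p a b s r) i * q_binomial N (digit_number p a b s r))"
proof (rule q_int_dvd_if_roots)
  show "1 < p ^ n" using assms(2) prime_gt_1_nat[OF assms(1)] by (intro one_less_power) auto
next
  fix z :: complex
  assume "z ^ (p ^ n) = 1" "z \<noteq> 1"
  then obtain m where m: "0 < m" "m \<le> n" "z ^ (p ^ m) = 1" "\<And>j. 0 < j \<Longrightarrow> j < p ^ m \<Longrightarrow> z ^ j \<noteq> 1"
    using root_of_unity_primitive_prime_power[OF assms(1)] by blast
  \<comment> \<open>The condition on \<open>N + i\<close> descends from \<open>p ^ n\<close> to
    \<open>p ^ m\<close> by truncating the repeated digits.\<close>
  have "(N + i) mod p ^ n mod p ^ m = (N + i) mod p ^ m"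
    using m(2) by (simp add: mod_mod_cancel le_imp_power_dvd)
  then have "(N + i) mod p ^ m = (\<Sum>j<m. (a + b) * p ^ j)"
    unfolding N sum_digits_mod[OF assms(5) m(2)] by simp
  from signed_sum_eq_0[OF m(3,4,1,2) _ assms(4,5) this, of s]
  show "poly (of_int_poly (\<Sum>r<2 ^ n. (- 1) ^ r * q_binomial (digit_number p a b s r) i *
      q_binomial N (digit_number p a b s r))) z = 0"
    using m(2) assms(3) by (simp add: of_int_poly_hom.hom_sum poly_sum hom_distribs)
qed

lemma poly_q_binomial_1: "poly (q_binomial n k) 1 = int (n choose k)"
proof (induction n arbitrary: k)
  case 0
  show ?case by (cases k) (simp_all add: q_binomial_0_right q_binomial_0_left)
next
  case (Suc n)
  then show ?case by (cases k) (simp_all add: q_binomial_0_right q_binomial_Suc poly_monom)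
qed

lemma poly_q_int_1: "poly (q_int n) 1 = int n"
  by (simp add: q_int_eq_sum poly_sum poly_monom)

section \<open>Approximation of p-adic arguments by natural numbers\<close>

text \<open>Each of the finitely many conditions holds once \<open>N\<close> is close enough to
  \<open>x\<close>. The sum of the exponents is a common precision, and a residue of
  \<open>x\<close> supplies \<open>N\<close>.\<close>

lemma natural_approximation:
  fixes x :: "'p::prime_card padic_int"
  assumes "finite A" "\<And>k. k \<in> A \<Longrightarrow> \<exists>d. \<forall>N. of_nat CARD('p) ^ d dvd of_nat N - x \<longrightarrow> Q N k"
  obtains N where "of_nat CARD('p) ^ n dvd of_nat N - x" "\<And>k. k \<in> A \<Longrightarrow> Q N k"
proof -
  obtain d where d: "\<And>k N. k \<in> A \<Longrightarrow> of_nat CARD('p) ^ d k dvd of_nat N - x \<Longrightarrow> Q N k"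
    using assms(2) by metis
  define D where "D = n + sum d A"
  define N where "N = nat (residue x D)"
  have N: "of_nat CARD('p) ^ D dvd of_nat N - x"
    using p_power_dvd_diff_residue[of D x] unfolding N_def by (simp only: p_power_dvd_diff_iff)
  have "of_nat CARD('p) ^ e dvd of_nat N - x" if "e \<le> D" for e
    using dvd_trans[OF le_imp_power_dvd[OF that] N] .
  moreover have "d k \<le> D" if "k \<in> A" for k
    using member_le_sum[OF that, of d] assms(1) by (simp add: D_def)
  moreover have "n \<le> D" by (simp add: D_def)
  ultimately show ?thesis using that d by blast
qed

text \<open>Multiplying the difference by \<open>1 - p\<close> telescopes the geometric sum and
  leaves a multiple of \<open>p ^ n\<close>; the factor \<open>p - 1\<close> is coprime to
  \<open>p\<close> and can be cancelled.\<close>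

lemma padic_alpha_approx:
  assumes "even (a + b)"
  shows "of_nat CARD('p) ^ n dvd
    (padic_alpha a b :: 'p::prime_card padic_int) - of_nat (\<Sum>j<n. (a + b) div 2 * CARD('p) ^ j)"
proof -
  let ?p = "of_nat CARD('p) :: 'p padic_int"
  define c where "c = (a + b) div 2"
  define y where "y = (padic_alpha a b :: 'p padic_int) - of_nat (\<Sum>j<n. c * CARD('p) ^ j)"
  have T: "(1 - ?p) * of_nat (\<Sum>j<n. c * CARD('p) ^ j) = of_nat c * (1 - ?p ^ n)"
    unfolding one_diff_power_eq by (simp add: sum_distrib_left mult_ac)
  have "2 * ((1 - ?p) * padic_alpha a b) = 2 * (of_nat c :: 'p padic_int)"
  proof -
    have "of_nat (a + b) = (of_nat (2 * c) :: 'p padic_int)" using assms by (simp add: c_def)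
    then show ?thesis using padic_alpha_closed_form[OF assms, where ?'p = 'p]
      by (simp only: mult.assoc of_nat_mult of_nat_numeral)
  qed
  then have "(1 - ?p) * padic_alpha a b = of_nat c" by simp
  then have "(1 - ?p) * y = of_nat c * ?p ^ n"
    unfolding y_def right_diff_distrib T by (simp add: algebra_simps)
  moreover have "of_nat (CARD('p) - 1) = ?p - 1"
    using CARD_prime_card_gt_1[where ?'p = 'p] by (simp add: of_nat_diff)
  ultimately have "of_nat (CARD('p) - 1) * y = - (of_nat c * ?p ^ n)"
    by (metis minus_diff_eq mult_minus_left)
  then have "?p ^ n dvd of_nat (CARD('p) - 1) * y" by simp
  moreover have "coprime (CARD('p) - 1) CARD('p)"
    by (rule coprime_diff_one_left_nat) simp
  ultimately have "?p ^ n dvd y" by (rule coprime_p_power_dvd_mult[rotated])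
  then show ?thesis by (simp add: y_def c_def)
qed

text \<open>Translates p-adic closeness into the digit condition of
  \<open>q_int_dvd_signed_sum\<close>; the repeated-digit sum is below \<open>p ^ n\<close>, hence
  its own residue.\<close>

lemma padic_alpha_approx_mod:
  assumes "even (a + b)" "(a + b) div 2 < CARD('p)"
    and "of_nat CARD('p) ^ n dvd of_nat N - (padic_alpha a b - of_nat i :: 'p::prime_card padic_int)"
  shows "(N + i) mod CARD('p) ^ n = (\<Sum>j<n. (a + b) div 2 * CARD('p) ^ j)"
proof -
  let ?T = "\<Sum>j<n. (a + b) div 2 * CARD('p) ^ j"
  have "of_nat CARD('p) ^ n dvd of_nat (N + i) - (of_nat ?T :: 'p padic_int)"
    using dvd_add[OF assms(3) padic_alpha_approx[OF assms(1), of n]] by (simp add: algebra_simps)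
  then have "int ((N + i) mod CARD('p) ^ n) = int (?T mod CARD('p) ^ n)"
    unfolding p_power_dvd_diff_iff by (simp only: residue_of_nat zmod_int of_nat_power)
  then have "(N + i) mod CARD('p) ^ n = ?T mod CARD('p) ^ n" by (simp only: of_nat_eq_iff)
  then show ?thesis using sum_digits_less[OF assms(2), of n] by simp
qed

text \<open>Multiplied by \<open>k!\<close>, both coefficients become products that agree to the
  precision of \<open>N\<close>. With \<open>k! = p ^ v * w\<close> and \<open>w\<close> prime to
  \<open>p\<close>, dividing by \<open>k!\<close> costs \<open>v\<close> digits.\<close>

lemma padic_binomial_continuous:
  fixes x :: "'p::prime_card padic_int"
  shows "\<exists>d. \<forall>N. of_nat CARD('p) ^ d dvd of_nat N - x \<longrightarrow>
    of_nat CARD('p) ^ n dvd padic_binomial x k - of_nat (N choose k)"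
proof -
  let ?p = "of_nat CARD('p) :: 'p padic_int"
  define v where "v = multiplicity CARD('p) (fact k :: nat)"
  have prime: "prime CARD('p)" by (rule prime_card)
  obtain w where w: "fact k = CARD('p) ^ v * w" "\<not> CARD('p) dvd w"
    using multiplicity_decompose'[of "fact k :: nat" "CARD('p)"] prime_gt_1_nat[OF prime]
    unfolding v_def by (metis fact_nonzero less_irrefl nat_dvd_1_iff_1)
  then have "coprime w CARD('p)"
    using prime by (metis prime_imp_coprime coprime_commute)
  have fact: "fact k = ?p ^ v * of_nat w"
    using arg_cong[OF w(1), of "of_nat :: nat \<Rightarrow> 'p padic_int"] by simp
  have "?p ^ n dvd padic_binomial x k - of_nat (N choose k)"
    if N: "?p ^ (v + n) dvd of_nat N - x" for N
  proof -
    have "?p ^ (v + n) dvd x - of_nat N" using N by (simp only: p_power_dvd_diff_iff)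
    then have "?p ^ (v + n) dvd (\<Prod>i<k. x - of_nat i) - (\<Prod>i<k. of_nat N - of_nat i)"
      by (intro dvd_prod_diff) simp
    then have "?p ^ v * ?p ^ n dvd ?p ^ v * (of_nat w * (padic_binomial x k - of_nat (N choose k)))"
      unfolding fact_mult_padic_binomial[symmetric] padic_binomial_of_nat fact
      by (simp add: algebra_simps power_add)
    then have "?p ^ n dvd of_nat w * (padic_binomial x k - of_nat (N choose k))"
      using CARD_prime_card_gt_1[where ?'p = 'p] by simp
    then show ?thesis by (rule coprime_p_power_dvd_mult[OF \<open>coprime w CARD('p)\<close>])
  qed
  then show ?thesis by blast
qed

section \<open>Passage to the p-adic sums\<close>

text \<open>The remainder modulo \<open>P\<close> has coefficients divisible by every power of
  \<open>p\<close>, so it is zero.\<close>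

lemma dvd_if_cong_mod_ideal_all:
  fixes P :: "'p::prime_card padic_int poly"
  assumes P: "lead_coeff P = 1" "0 < degree P" and cong: "\<And>e. cong_mod_ideal P e f 0"
  shows "P dvd f"
proof -
  obtain h r where hr: "f = P * h + r" "degree r < degree P"
    using monic_remainder[OF P] by blast
  have "cong_mod_ideal P e r 0" for e
  proof -
    have "cong_mod_ideal P e r f" unfolding hr(1) by (rule cong_mod_ideal_dvd) simp
    then show ?thesis using cong by (rule cong_mod_ideal_trans)
  qed
  then have "of_nat CARD('p) ^ e dvd coeff r j" for e j
    using cong_mod_ideal_degree_less[OF P hr(2), of 0 e j] P(2) by simp
  then have "r = 0" by (intro poly_eqI) (simp add: p_power_dvd_all)
  then show ?thesis by (simp add: hr(1))
qed

lemma cong_mod_ideal_sum: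
  assumes "\<And>r. r \<in> A \<Longrightarrow> cong_mod_ideal P e (f r) (g r)"
  shows "cong_mod_ideal P e (sum f A) (sum g A)"
  using assms
  by (induction A rule: infinite_finite_induct) (simp_all add: cong_mod_ideal_refl cong_mod_ideal_add)

text \<open>Treats (a) and (b) together, \<open>P\<close> being any nonconstant monic divisor of
  \<open>[p ^ n]\<close>. For each precision \<open>e\<close> a natural \<open>N\<close> replaces
  the p-adic upper argument, and \<open>P\<close> divides the resulting integral sum.\<close>

lemma dvd_padic_signed_sum:
  fixes P :: "'p::prime_card padic_int poly" and p :: nat
  assumes P: "lead_coeff P = 1" "0 < degree P" "P dvd of_int_poly (q_int (p ^ n))"
    and p: "p = CARD('p)" and ns: "1 \<le> n" "n \<le> s"
    and ab: "a \<le> b" "a + b < p"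
  defines "K \<equiv> digit_number p a b s"
  shows "P dvd (\<Sum>r<2 ^ n. (- 1) ^ r * of_int_poly (q_binomial (K r) i) *
    padic_q_binomial P (padic_alpha (2 * a) (2 * b) - of_nat i) (K r))"
proof (rule dvd_if_cong_mod_ideal_all[OF P(1,2)])
  fix e
  let ?x = "padic_alpha (2 * a) (2 * b) - of_nat i :: 'p padic_int"
  have "\<exists>d. \<forall>N. of_nat CARD('p) ^ d dvd of_nat N - ?x \<longrightarrow>
      cong_mod_ideal P e (of_int_poly (q_binomial N k)) (padic_q_binomial P ?x k)" for k
    using padic_q_binomial_characterization(2)[OF P(1,2) P(3)[unfolded p]]
    unfolding q_binomial_tendsto_def by blast
  \<comment> \<open>Only finitely many lower indices \<open>K r\<close> occur, so one
    \<open>N\<close> serves them all and is also correct modulo \<open>p ^ n\<close>.\<close>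
  note * = natural_approximation[where Q = "\<lambda>N k. cong_mod_ideal P e (of_int_poly (q_binomial N k)) (padic_q_binomial P ?x k)",
      OF _ this, of "K ` {..<2 ^ n}" n]
  obtain N where N: "of_nat CARD('p) ^ n dvd of_nat N - ?x"
    "\<And>k. k \<in> K ` {..<2 ^ n} \<Longrightarrow>
      cong_mod_ideal P e (of_int_poly (q_binomial N k)) (padic_q_binomial P ?x k)"
    by (rule *) blast+
  define S where "S = (\<Sum>r<2 ^ n. (- 1) ^ r * q_binomial (K r) i * q_binomial N (K r))"
  have "cong_mod_ideal P e
    (\<Sum>r<2 ^ n. (- 1) ^ r * of_int_poly (q_binomial (K r) i) * of_int_poly (q_binomial N (K r)))
    (\<Sum>r<2 ^ n. (- 1) ^ r * of_int_poly (q_binomial (K r) i) * padic_q_binomial P ?x (K r))"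
    by (intro cong_mod_ideal_sum cong_mod_ideal_mult N(2)) auto
  also have "(\<Sum>r<2 ^ n. (- 1) ^ r * of_int_poly (q_binomial (K r) i) * of_int_poly (q_binomial N (K r))) =
      (of_int_poly S :: 'p padic_int poly)"
    by (simp add: S_def of_int_poly_hom.hom_sum hom_distribs)
  finally have *: "cong_mod_ideal P e (of_int_poly S)
    (\<Sum>r<2 ^ n. (- 1) ^ r * of_int_poly (q_binomial (K r) i) * padic_q_binomial P ?x (K r))" .
  have "(N + i) mod p ^ n = (\<Sum>j<n. (a + b) * p ^ j)"
    using padic_alpha_approx_mod[OF _ _ N(1)] ab p by simp
  then have "q_int (p ^ n) dvd S"
    unfolding S_def K_def using prime_card[where ?'a = 'p] p ns ab by (intro q_int_dvd_signed_sum) auto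
  then have "P dvd of_int_poly S"
    using P(3) by (metis dvd_trans of_int_poly_hom.hom_dvd)
  then have "cong_mod_ideal P e (of_int_poly S) 0" by (intro cong_mod_ideal_dvd) simp
  with cong_mod_ideal_sym[OF *] show "cong_mod_ideal P e
    (\<Sum>r<2 ^ n. (- 1) ^ r * of_int_poly (q_binomial (K r) i) * padic_q_binomial P ?x (K r)) 0"
    by (rule cong_mod_ideal_trans)
qed

lemma p_power_dvd_padic_signed_sum:
  fixes p :: nat
  assumes p: "p = CARD('p::prime_card)" and ns: "1 \<le> n" "n \<le> s"
    and ab: "a \<le> b" "a + b < p"
  defines "K \<equiv> digit_number p a b s"
  shows "of_nat (p ^ n) dvd (\<Sum>r<2 ^ n. (- 1) ^ r * of_nat (K r choose i) *
    padic_binomial (padic_alpha (2 * a) (2 * b) - of_nat i :: 'p padic_int) (K r))"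
proof -
  let ?x = "padic_alpha (2 * a) (2 * b) - of_nat i :: 'p padic_int"
  obtain N where N: "of_nat CARD('p) ^ n dvd of_nat N - ?x"
    "\<And>k. k \<in> K ` {..<2 ^ n} \<Longrightarrow> of_nat CARD('p) ^ n dvd padic_binomial ?x k - of_nat (N choose k)"
    by (rule natural_approximation[
        where Q = "\<lambda>N k. of_nat CARD('p) ^ n dvd padic_binomial ?x k - of_nat (N choose k)",
        OF _ padic_binomial_continuous, of "K ` {..<2 ^ n}" n]) blast+
  have "(N + i) mod p ^ n = (\<Sum>j<n. (a + b) * p ^ j)"
    using padic_alpha_approx_mod[OF _ _ N(1)] ab p by simp
  then have "q_int (p ^ n) dvd (\<Sum>r<2 ^ n. (- 1) ^ r * q_binomial (K r) i * q_binomial N (K r))"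
    unfolding K_def using prime_card[where ?'a = 'p] p ns ab by (intro q_int_dvd_signed_sum) auto
  \<comment> \<open>At q = 1, \<open>[p ^ n]\<close> becomes \<open>p ^ n\<close> and Gaussian
    coefficients become ordinary ones.\<close>
  then have "poly (q_int (p ^ n)) 1 dvd
      poly (\<Sum>r<2 ^ n. (- 1) ^ r * q_binomial (K r) i * q_binomial N (K r)) 1"
    by (auto simp only: dvd_def poly_mult)
  then have "int (p ^ n) dvd (\<Sum>r<2 ^ n. (- 1) ^ r * int (K r choose i) * int (N choose K r))"
    by (simp add: poly_sum poly_q_binomial_1 poly_q_int_1)
  then have "(of_int (int (p ^ n)) :: 'p padic_int) dvd
      of_int (\<Sum>r<2 ^ n. (- 1) ^ r * int (K r choose i) * int (N choose K r))"
    by (metis dvd_def of_int_mult)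
  then have "of_nat (p ^ n) dvd
      (\<Sum>r<2 ^ n. (- 1) ^ r * of_nat (K r choose i) * of_nat (N choose K r) :: 'p padic_int)"
    by simp
  \<comment> \<open>Returning from \<open>N\<close> to the p-adic upper argument changes the sum by
    a multiple of \<open>p ^ n\<close>.\<close>
  moreover have "of_nat (p ^ n) dvd
    (\<Sum>r<2 ^ n. (- 1) ^ r * of_nat (K r choose i) * (padic_binomial ?x (K r) - of_nat (N choose K r)))"
    using N(2) p by (intro dvd_sum dvd_mult) auto
  ultimately have "of_nat (p ^ n) dvd
    (\<Sum>r<2 ^ n. (- 1) ^ r * of_nat (K r choose i) * of_nat (N choose K r)) +
    (\<Sum>r<2 ^ n. (- 1) ^ r * of_nat (K r choose i) * (padic_binomial ?x (K r) - of_nat (N choose K r)))"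
    by (rule dvd_add)
  then show ?thesis by (simp add: sum.distrib[symmetric] algebra_simps)
qed

theorem corollary2p7:
  fixes p a b n s i :: nat
  assumes p: "p = CARD('p::prime_card)" "p > 2"
    and ab: "even a" "even b" "a < b" "b \<le> p - 1"
    and ns: "1 \<le> n" "n \<le> s"
  shows
    "(\<forall>m. 1 \<le> m \<and> m \<le> n \<longrightarrow>
      of_int_poly (cyclotomic (p ^ m)) dvd
        (\<Sum>r<2 ^ n. (- 1) ^ r * of_int_poly (q_binomial (digit_number p a b s r div 2) i) *
          padic_q_binomial (of_int_poly (cyclotomic (p ^ m)))
            (padic_alpha a b - of_nat i :: 'p padic_int) (digit_number p a b s r div 2))) \<and>
    of_int_poly (q_int (p ^ n)) dvd
      (\<Sum>r<2 ^ n. (- 1) ^ r * of_int_poly (q_binomial (digit_number p a b s r div 2) i) *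
        padic_q_binomial (of_int_poly (q_int (p ^ n)))
          (padic_alpha a b - of_nat i :: 'p padic_int) (digit_number p a b s r div 2)) \<and>
    of_nat (p ^ n) dvd
      (\<Sum>r<2 ^ n. (- 1) ^ r * of_nat (digit_number p a b s r div 2 choose i) *
        padic_binomial (padic_alpha a b - of_nat i :: 'p padic_int) (digit_number p a b s r div 2))"
proof -
  \<comment> \<open>For the halved digits, \<open>a < b \<le> p - 1\<close> gives
    \<open>A + B < p\<close>, so the repeated digit of \<alpha> is a genuine base-\<open>p\<close>
    digit.\<close>
  define A B where "A = a div 2" and "B = b div 2"
  have AB: "a = 2 * A" "b = 2 * B" "A \<le> B" "A + B < p"
    using p(2) ab by (auto simp: A_def B_def)
  have K: "digit_number p a b s r div 2 = digit_number p A B s r" for r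
    unfolding A_def B_def by (rule digit_number_half[OF ab(1,2)])
  \<comment> \<open>Parts (a) and (b) take for \<open>P\<close> the cyclotomic polynomial and
    \<open>[p ^ n]\<close>, both admissible moduli.\<close>
  show ?thesis
    unfolding K unfolding AB(1,2)
    using dvd_padic_signed_sum[OF _ _ _ p(1) ns AB(3,4)] p_power_dvd_padic_signed_sum[OF p(1) ns AB(3,4)]
      q_int_admissible[OF ns(1), where ?'p = 'p] cyclotomic_admissible[where ?'p = 'p, of _ n] p(1)
    by auto
qed

end
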